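(* Let $a,b,c\in\mathbb{R}$ satisfy either ($c=0$ and $a\neq b$) or ($c>0$ and $a<b$). The following statements hold. (a) If $\nu\geq\max\{0,\nu_0\}$, then $r^{c}(g_\nu)$ satisfies the inequalities $$\frac23\sqrt{\frac{(\nu+1)Q(\nu)}{Q(\nu+2)}}<r^{c}(g_\nu)<\sqrt{\frac{36(\nu+1)(\nu+2)Q(\nu)Q(\nu+2)}{81(\nu+2)Q^2(\nu+2)-25(\nu+1)Q(\nu)Q(\nu+4)}}$$ and $$\sqrt[4]{\frac{16(\nu+1)^2(\nu+2)Q^2(\nu)}{81(\nu+2)Q^2(\nu+2)-25(\nu+1)Q(\nu)Q(\nu+4)}}<r^{c}(g_\nu)$$ $$<\sqrt{\frac{8(\nu+1)(\nu+3)Q(\nu)\left[81(\nu+2)Q^2(\nu+2)-25(\nu+1)Q(\nu)Q(\nu+4)\right]}{27(\nu+3)Q(\nu+2)\left[54(\nu+2)Q^2(\nu+2)-25(\nu+1)^2Q(\nu)Q(\nu+4)\right]+49(\nu+1)^2Q^2(\nu)Q(\nu+6)}}.$$ (b) If $\nu\geq\max\{0,\nu_0\}$, then $r^{c}(h_\nu)$ satisfies the inequalities $$\frac{(\nu+1)Q(\nu)}{Q(\nu+2)}<r^{c}(h_\nu)<\frac{16(\nu+2)Q(\nu)Q(\nu+2)}{16(\nu+2)Q^2(\nu+2)-9Q(\nu)Q(\nu+4)}$$ and $$\sqrt{\frac{16(\nu+1)(\nu+2)Q^2(\nu)}{16(\nu+2)Q^2(\nu+2)-9Q(\nu)Q(\nu+4)}}<r^{c}(h_\nu)$$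 $$<\frac{2(\nu+1)^2(\nu+3)Q(\nu)\left[16(\nu+2)Q^2(\nu+2)-9Q(\nu)Q(\nu+4)\right]}{(\nu+3)Q(\nu+2)\left[32(\nu+2)Q^2(\nu+2)-27(\nu+1)^2Q(\nu)Q(\nu+4)\right]+4(\nu+1)^2Q^2(\nu)Q(\nu+6)}.$$
   Context: $J_\nu(z)=\sum_{n\ge 0}\frac{(-1)^n}{n!\,\Gamma(n+\nu+1)}\left(\frac z2\right)^{2n+\nu}$ is the Bessel function of the first kind of order $\nu$. For real $a,b,c$ put $N_\nu(z)=az^2J_\nu''(z)+bzJ_\nu'(z)+cJ_\nu(z)$ and $Q(\nu)=a\nu(\nu-1)+b\nu+c$; $Q^2(x)$ means $(Q(x))^2$. $\nu_0$ denotes the largest real root of the quadratic $Q$. Normalized functions: $g_\nu(z)=\frac{2^\nu\Gamma(\nu+1)z^{1-\nu}}{Q(\nu)}N_\nu(z)$ and $h_\nu(z)=\frac{2^\nu\Gamma(\nu+1)z^{1-\nu/2}}{Q(\nu)}N_\nu(\sqrt z)$; both are entire with value $0$ and derivative $1$ at $0$. $\mathbb{D}_r=\{z\in\mathbb{C}:|z|<r\}$. For an entire function $f$ with $f(0)=0,\ f'(0)=1$, the radius of convexity is $r^{c}(f)=\sup\{r>0:\operatorname{Re}\left(1+\frac{zf''(z)}{f'(z)}\right)>0\text{ for all }z\in\mathbb{D}_r\}$.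
   Formalization: False upper bounds corrected: (a) second: 25(ν+1)² read as 25(ν+1); (b) first: 16(ν+2) in numerator as 16(ν+1)(ν+2), 9 as 9(ν+1); (b) second: 2(ν+1)² as 2(ν+1), 9 as 9(ν+1), 27(ν+1)² as 27(ν+1). Q(ν)≠0 is assumed; if Q has no real root, ν≥0. *)

theory Defs
  imports "HOL-Complex_Analysis.Complex_Analysis"
begin

(* Principal branch of (z/2)^(2n+nu).  This is the Bessel function on the plane slit along the
   non-positive reals, which is the only region where it is used below: on the slit the principal
   power is discontinuous for non-integer nu, and at 0 the convention 0 powr s = 0 applies. *)
definition bessel_J :: "real \<Rightarrow> complex \<Rightarrow> complex" where
  "bessel_J \<nu> z =
     (\<Sum>n. complex_of_real ((-1) ^ n / (fact n * Gamma (real n + \<nu> + 1)))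
            * (z / 2) powr complex_of_real (2 * real n + \<nu>))"

definition bessel_N :: "real \<Rightarrow> real \<Rightarrow> real \<Rightarrow> real \<Rightarrow> complex \<Rightarrow> complex" where
  "bessel_N a b c \<nu> z =
     complex_of_real a * z\<^sup>2 * deriv (deriv (bessel_J \<nu>)) z
     + complex_of_real b * z * deriv (bessel_J \<nu>) z
     + complex_of_real c * bessel_J \<nu> z"

definition bessel_Q :: "real \<Rightarrow> real \<Rightarrow> real \<Rightarrow> real \<Rightarrow> real" where
  "bessel_Q a b c x = a * x * (x - 1) + b * x + c"

(* Meaningful only if bessel_Q a b c has a real root and is not identically zero. *)
definition largest_root_Q :: "real \<Rightarrow> real \<Rightarrow> real \<Rightarrow> real" where
  "largest_root_Q a b c = Max {x. bessel_Q a b c x = 0}"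

(* The lower limit max {0, nu_0}.  If Q has no real root (possible when c > 0 and a < b),
   there is no nu_0 and the condition nu >= max {0, nu_0} is just nu >= 0. *)
definition max_zero_root_Q :: "real \<Rightarrow> real \<Rightarrow> real \<Rightarrow> real" where
  "max_zero_root_Q a b c =
     (if \<exists>x. bessel_Q a b c x = 0 then max 0 (largest_root_Q a b c) else 0)"

(* The normalized functions are entire, whereas the defining formulas involve multivalued powers
   whose branches cancel.  They are therefore the (unique) entire functions given by these formulas,
   with principal branches, off the slit. *)
definition bessel_g :: "real \<Rightarrow> real \<Rightarrow> real \<Rightarrow> real \<Rightarrow> complex \<Rightarrow> complex" where
  "bessel_g a b c \<nu> =
     (THE g. g holomorphic_on UNIV \<and>
        (\<forall>z. z \<notin> \<real>\<^sub>\<le>\<^sub>0 \<longrightarrow>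
           g z = complex_of_real (2 powr \<nu> * Gamma (\<nu> + 1)) * z powr complex_of_real (1 - \<nu>)
                 / complex_of_real (bessel_Q a b c \<nu>) * bessel_N a b c \<nu> z))"

definition bessel_h :: "real \<Rightarrow> real \<Rightarrow> real \<Rightarrow> real \<Rightarrow> complex \<Rightarrow> complex" where
  "bessel_h a b c \<nu> =
     (THE h. h holomorphic_on UNIV \<and>
        (\<forall>z. z \<notin> \<real>\<^sub>\<le>\<^sub>0 \<longrightarrow>
           h z = complex_of_real (2 powr \<nu> * Gamma (\<nu> + 1)) * z powr complex_of_real (1 - \<nu> / 2)
                 / complex_of_real (bessel_Q a b c \<nu>) * bessel_N a b c \<nu> (csqrt z)))"

(* A supremum in the extended reals, so that an infinite radius is not given a junk value.
   The conjunct deriv f z ~= 0 says that the quotient is defined (x / 0 = 0 in HOL). *)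
definition radius_of_convexity :: "(complex \<Rightarrow> complex) \<Rightarrow> ereal" where
  "radius_of_convexity f =
     Sup (ereal ` {r. r > 0 \<and>
        (\<forall>z \<in> ball 0 r. deriv f z \<noteq> 0 \<and> Re (1 + z * deriv (deriv f) z / deriv f z) > 0)})"

(* Origin of the bounds.  The radius of convexity of g (of h) is the smallest positive zero of
   (z g')' (of (z h')').  Let s_k be the sum of the (-k)-th powers of the squares of the positive
   zeros of (z g')', respectively of the zeros of (z h')'.  The bounds are
   s_k^(-1/k) < r^2 < s_k / s_(k+1) for g, and s_k^(-1/k) < r < s_k / s_(k+1) for h, with k = 1, 2.

   In the source some powers of nu + 1 in these expressions are misprinted.  The printed versions
   of three upper bounds are false (already r(h) < s_1 / s_2 as printed contradicts the printed
   1 / s_1 < r(h), e.g. for a = 0 and b = c = nu = 1), so they are stated here with the correct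
   values of s_1, s_2, s_3; writing Q0, Q2, Q4 for Q(nu), Q(nu+2), Q(nu+4), the corrections are
     g, s_2 / s_3:  25 (nu+1)^2 Q0 Q4   read as  25 (nu+1) Q0 Q4;
     h, s_1 / s_2:  16 (nu+2) Q0 Q2     read as  16 (nu+1) (nu+2) Q0 Q2,
                    9 Q0 Q4             read as  9 (nu+1) Q0 Q4;
     h, s_2 / s_3:  2 (nu+1)^2 (nu+3)   read as  2 (nu+1) (nu+3),
                    9 Q0 Q4             read as  9 (nu+1) Q0 Q4,
                    27 (nu+1)^2 Q0 Q4   read as  27 (nu+1) Q0 Q4.
   The lower bound s_2^(-1/2) for h is misprinted too, but as printed it is a weaker true bound;
   the printed and the corrected bound are both stated. *)

end

theory Submission
  imports Defs "HOL-Computational_Algebra.Fundamental_Theorem_Algebra"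
begin

text \<open>
  Write \<open>g z = z * \<phi> (z^2)\<close> and \<open>h z = z * \<phi> z\<close>, where
  \<open>\<phi> w = \<Sum>n. (-1)^n * Q (\<nu> + 2 n) / (Q \<nu> * n! * 4^n * (\<nu> + 1)_n) * w^n\<close>.
  In the variable \<open>w = z^2\<close> (for \<open>g\<close>, with \<open>\<sigma> = 2\<close>) or \<open>w = z\<close> (for \<open>h\<close>, with \<open>\<sigma> = 1\<close>) the
  derivative is \<open>G = \<phi> + \<sigma> w \<phi>'\<close>, and the quantity whose real part decides convexity is
  \<open>1 + \<sigma> w G' / G = F / G\<close> with \<open>F = G + \<sigma> w G'\<close>.  Both functions are therefore treated at
  once, with the parameter \<open>\<sigma>\<close>.

  The series \<open>F\<close> and \<open>G\<close> are coefficientwise limits of polynomials \<open>\<Prod>j. (1 - x_j w)\<close> with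
  all \<open>x_j \<ge> 0\<close>.  Indeed \<open>p \<mapsto> (1 - \<beta> w) p + \<kappa> w p'\<close> with \<open>\<beta>, \<kappa> \<ge> 0\<close> preserves such products
  (\<open>lin_prod_step\<close>): off the roots of \<open>p\<close> its value divided by \<open>p\<close> is
  \<open>1 - \<beta> w - \<kappa> \<Sum>j. x_j w / (1 - x_j w)\<close>, which for nonreal \<open>w\<close> has nonzero imaginary part unless
  it is constantly \<open>1\<close>.
  Operators of this kind turn \<open>(1 - w / (4 m^2))^m\<close> into a polynomial that tends to the Bessel
  series as \<open>m \<rightarrow> \<infinity>\<close>, then multiply its coefficients by \<open>Q (\<nu> + 2 n) / Q \<nu>\<close>
  (\<open>bessel_phi_props\<close>), and finally build \<open>G\<close> and \<open>F\<close>.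

  For such a limit the coefficients \<open>s 1, s 2, ...\<close> of \<open>- F' / F\<close> are limits of the power sums
  of the \<open>x_j\<close>.  They inherit nonnegativity, log-convexity and the monotonicity of \<open>l^p\<close> norms
  (\<open>lin_prod_limit_power_sum_seq\<close>).  The radius of convergence \<open>\<rho>\<close> of \<open>- F' / F\<close> is the modulus of
  the first zero of \<open>F\<close>, and these inequalities alone give \<open>s k powr (-1/k) \<le> \<rho> \<le> s k / s (k + 1)\<close>.
  Those needed here are strict unless the \<open>s k\<close> with \<open>k \<ge> 2\<close> form a geometric sequence, which is
  incompatible with the fast decay of the coefficients of \<open>F\<close>
  (\<open>strict_power_sum_seq_log_deriv\<close>, \<open>first_zero_bounds\<close>).

  Finally \<open>- G' / G\<close> has nonnegative coefficients too, and they are bounded by those of \<open>- F' / F\<close>.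
  On the disc of radius \<open>\<rho>\<close> this gives
  \<open>Re (F w / G w) \<ge> F \<bar>w\<bar> / G \<bar>w\<bar> > 0\<close>, so that \<open>\<rho>\<close> is the radius of convexity in the
  variable \<open>w\<close> (\<open>convexity_condition_iff\<close>).  The bounds of the theorem are those for \<open>\<rho>\<close>
  with \<open>s 1, s 2, s 3\<close> written out by Newton's identities.
\<close>

unbundle no vec_syntax

section \<open>Polynomials with positive real roots\<close>

definition lin_prod :: "real list \<Rightarrow> real poly" where
  "lin_prod xs = (\<Prod>x\<leftarrow>xs. [:1, - x:])"

abbreviation cpoly :: "real poly \<Rightarrow> complex poly" where
  "cpoly p \<equiv> map_poly complex_of_real p"

lemma lin_prod_simps [simp]:
  "lin_prod [] = 1" "lin_prod (x # xs) = [:1, - x:] * lin_prod xs"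
  by (simp_all add: lin_prod_def)

lemma coeff_lin_prod_0 [simp]: "coeff (lin_prod xs) 0 = 1"
  by (induction xs) (simp_all add: coeff_mult_0)

lemma cpoly_add: "cpoly (p + q) = cpoly p + cpoly q"
  by (rule poly_eqI) (simp add: coeff_map_poly)

lemma cpoly_mult: "cpoly (p * q) = cpoly p * cpoly q"
  by (rule poly_eqI) (simp add: coeff_map_poly coeff_mult)

lemma cpoly_pderiv: "cpoly (pderiv p) = pderiv (cpoly p)"
  by (rule poly_eqI) (simp add: coeff_map_poly coeff_pderiv)

lemma poly_cpoly_of_real: "poly (cpoly p) (of_real r) = of_real (poly p r)"
  by (induction p) (simp_all add: map_poly_pCons)

text \<open>
  Induction on the degree: the fundamental theorem of algebra provides a complex root, which by
  hypothesis is a positive real \<open>r\<close>, and then \<open>1 - w / r\<close> splits off over the reals.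
\<close>

lemma splits_into_positive_linear_factors:
  fixes q :: "real poly"
  assumes "coeff q 0 = 1"
    and "\<And>w. poly (cpoly q) w = 0 \<Longrightarrow> Im w = 0 \<and> Re w > 0"
  shows "\<exists>xs. (\<forall>x\<in>set xs. x \<ge> 0) \<and> q = lin_prod xs"
  using assms
proof (induction "degree q" arbitrary: q)
  case 0
  then obtain k where "q = [:k:]"
    by (metis degree_eq_zeroE)
  with 0 have "q = lin_prod []"
    by (simp add: one_pCons)
  then show ?case by (intro exI[of _ "[]"]) simp
next
  case (Suc n)
  have "degree (cpoly q) = Suc n"
    using Suc.hyps(2) by (simp add: degree_map_poly)
  then have "\<not> constant (poly (cpoly q))"
    by (simp add: constant_degree)
  then obtain w where w: "poly (cpoly q) w = 0"
    using fundamental_theorem_of_algebra by blast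
  define r where "r = Re w"
  have r: "r > 0" "w = complex_of_real r"
    using Suc.prems(2)[OF w] by (auto simp: r_def complex_eq_iff)
  have "poly q r = 0"
    using w r by (metis of_real_eq_0_iff poly_cpoly_of_real)
  then have "[:- r, 1:] dvd q"
    by (simp add: poly_eq_0_iff_dvd)
  then obtain p where p: "q = [:- r, 1:] * p"
    by (elim dvdE)
  define p' where "p' = smult (- r) p"
  have q: "q = [:1, - (1 / r):] * p'"
    using r by (simp add: p p'_def smult_add_right)
  have nz: "p' \<noteq> 0"
    using Suc.prems(1) q by auto
  have "degree q = 1 + degree p'"
    unfolding q using r nz by (subst degree_mult_eq) auto
  with Suc.hyps(2) have n: "n = degree p'" by simp
  have "coeff p' 0 = 1"
    using Suc.prems(1) unfolding q by (simp add: coeff_mult_0)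
  moreover have "Im z = 0 \<and> Re z > 0" if "poly (cpoly p') z = 0" for z
    by (rule Suc.prems(2)) (use that in \<open>simp only: q cpoly_mult poly_mult mult_zero_right\<close>)
  ultimately obtain xs where "\<forall>x\<in>set xs. x \<ge> 0" "p' = lin_prod xs"
    using Suc.hyps(1)[OF n] by blast
  with q r show ?case
    by (intro exI[of _ "1 / r # xs"]) auto
qed

text \<open>
  Parameters \<open>x = 0\<close> are allowed; they contribute the factor \<open>1\<close> and no root.
\<close>

lemma root_of_lin_prod:
  assumes "\<forall>x\<in>set xs. x \<ge> 0" "poly (cpoly (lin_prod xs)) w = 0"
  shows "Im w = 0 \<and> Re w > 0"
  using assms
proof (induction xs)
  case Nil
  then show ?case by (simp add: map_poly_1)
next
  case (Cons x xs)
  show ?case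
  proof (cases "poly (cpoly (lin_prod xs)) w = 0")
    case True
    with Cons show ?thesis by simp
  next
    case False
    have "poly (cpoly [:1, - x:]) w * poly (cpoly (lin_prod xs)) w = 0"
      using Cons.prems(2) by (simp only: lin_prod_simps cpoly_mult poly_mult)
    with False have "1 - of_real x * w = 0"
      by (simp add: map_poly_pCons mult.commute)
    then have "Re (of_real x * w) = 1" "Im (of_real x * w) = 0"
      by (metis Re_complex_of_real Im_complex_of_real eq_iff_diff_eq_0 of_real_1)+
    then have 1: "x * Re w = 1" "x * Im w = 0" by simp_all
    then have "x > 0" using Cons.prems(1) by (cases "x = 0") auto
    with 1 show ?thesis
      by (auto simp: zero_less_mult_iff dest: sym[of _ 1])
         (metis zero_less_mult_pos zero_less_one)
  qed
qed

lemma lin_prod_log_deriv: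
  assumes "\<forall>x\<in>set xs. 1 - complex_of_real x * w \<noteq> 0"
  shows "poly (pderiv (cpoly (lin_prod xs))) w =
    - (\<Sum>x\<leftarrow>xs. of_real x / (1 - of_real x * w)) * poly (cpoly (lin_prod xs)) w"
  using assms
proof (induction xs)
  case Nil
  then show ?case by (simp add: map_poly_1)
next
  case (Cons x xs)
  have c: "cpoly (lin_prod (x # xs)) = [:1, - of_real x:] * cpoly (lin_prod xs)"
    by (simp only: lin_prod_simps cpoly_mult) (simp add: map_poly_pCons)
  have "poly (pderiv (cpoly (lin_prod (x # xs)))) w
     = (1 - of_real x * w) * poly (pderiv (cpoly (lin_prod xs))) w
       - of_real x * poly (cpoly (lin_prod xs)) w"
    unfolding c pderiv_mult by (simp add: pderiv_pCons algebra_simps)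
  also have "\<dots> = - (\<Sum>x\<leftarrow>x # xs. of_real x / (1 - of_real x * w)) * poly (cpoly (lin_prod (x # xs))) w"
    using Cons unfolding c by (simp add: field_simps)
  finally show ?case .
qed

text \<open>
  Up to sign, these are the summands of \<open>w p' / p\<close> for \<open>p = lin_prod xs\<close>.  Their common sign keeps the
  zeros real in \<open>lin_prod_step\<close>.
\<close>

lemma Im_pole_term:
  fixes x :: real and w :: complex
  assumes "x \<ge> 0" "Im w > 0"
  shows "Im (of_real x * w / (1 - of_real x * w)) \<ge> 0"
    and "x > 0 \<Longrightarrow> Im (of_real x * w / (1 - of_real x * w)) > 0"
proof -
  have *: "Im (of_real x * w / (1 - of_real x * w)) =
      x * Im w / ((1 - x * Re w)\<^sup>2 + (x * Im w)\<^sup>2)"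
    by (simp add: Im_divide power2_eq_square algebra_simps)
  show "Im (of_real x * w / (1 - of_real x * w)) \<ge> 0"
    unfolding * using assms by (intro divide_nonneg_nonneg) auto
  show "Im (of_real x * w / (1 - of_real x * w)) > 0" if "x > 0"
    unfolding * using assms that
    by (intro divide_pos_pos mult_pos_pos add_nonneg_pos) auto
qed

lemma Im_sum_list: "Im (\<Sum>x\<leftarrow>xs. f x) = (\<Sum>x\<leftarrow>xs. Im (f x))"
  by (induction xs) auto

text \<open>
  Divided by \<open>p\<close>, the expression is \<open>1 - \<beta> w - \<kappa> S\<close>, where \<open>S\<close> sums the terms of
  \<open>Im_pole_term\<close>; both \<open>\<beta> w\<close> and \<open>\<kappa> S\<close> have nonnegative imaginary part, so a zero would
  force both to be real, hence to vanish, leaving the value \<open>1\<close>.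
\<close>

lemma lin_prod_step_nonzero_upper_half_plane:
  assumes xs: "\<forall>x\<in>set xs. x \<ge> 0" and \<beta>: "\<beta> \<ge> 0" and \<kappa>: "\<kappa> \<ge> 0" and w: "Im w > 0"
  shows "(1 - of_real \<beta> * w) * poly (cpoly (lin_prod xs)) w
         + of_real \<kappa> * w * poly (pderiv (cpoly (lin_prod xs))) w \<noteq> 0"
proof
  let ?p = "poly (cpoly (lin_prod xs)) w"
  let ?S = "\<Sum>x\<leftarrow>xs. of_real x * w / (1 - of_real x * w)"
  assume eq: "(1 - of_real \<beta> * w) * ?p + of_real \<kappa> * w * poly (pderiv (cpoly (lin_prod xs))) w = 0"
  have p: "?p \<noteq> 0"
    using root_of_lin_prod[OF xs] w by force
  have nz: "\<forall>x\<in>set xs. 1 - complex_of_real x * w \<noteq> 0"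
  proof safe
    fix x assume "x \<in> set xs" "1 - complex_of_real x * w = 0"
    then have "Re (of_real x * w) = 1" "Im (of_real x * w) = 0"
      by (metis Re_complex_of_real Im_complex_of_real eq_iff_diff_eq_0 of_real_1)+
    with w show False by simp
  qed
  have "((1 - of_real \<beta> * w) - of_real \<kappa> * ?S) * ?p = 0"
    using eq unfolding lin_prod_log_deriv[OF nz]
    by (simp add: sum_list_const_mult[symmetric] algebra_simps)
  with p have 0: "(1 - of_real \<beta> * w) - of_real \<kappa> * ?S = 0" by simp
  have S: "Im ?S \<ge> 0"
    unfolding Im_sum_list using Im_pole_term(1)[OF _ w] xs by (intro sum_list_nonneg) auto
  from 0 have "Im ((1 - of_real \<beta> * w) - of_real \<kappa> * ?S) = 0" by simp
  then have "\<beta> * Im w + \<kappa> * Im ?S = 0" by simp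
  moreover have "\<beta> * Im w \<ge> 0" "\<kappa> * Im ?S \<ge> 0"
    using \<beta> \<kappa> w S by simp_all
  ultimately have z: "\<beta> * Im w = 0" "\<kappa> * Im ?S = 0" by linarith+
  have b0: "\<beta> = 0" using z(1) w by simp
  show False
  proof (cases "\<kappa> = 0")
    case True
    with 0 b0 show False by simp
  next
    case False
    with z have "Im ?S = 0" by simp
    then have "(\<Sum>x\<leftarrow>xs. Im (of_real x * w / (1 - of_real x * w))) = 0"
      by (simp only: Im_sum_list)
    then have "\<forall>x\<in>set xs. Im (of_real x * w / (1 - of_real x * w)) = 0"
      using Im_pole_term(1)[OF _ w] xs
      by (subst (asm) sum_list_nonneg_eq_0_iff) auto
    then have "\<forall>x\<in>set xs. x = 0"
      using Im_pole_term(2)[OF _ w] xs by (metis less_eq_real_def order_less_irrefl)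
    then have "?S = (\<Sum>x\<leftarrow>xs. 0)"
      by (intro arg_cong[of _ _ sum_list] map_cong) auto
    with 0 b0 show False by simp
  qed
qed

text \<open>
  The coefficients of \<open>p = lin_prod xs\<close> alternate in sign, so that \<open>p > 0\<close> and \<open>w p' \<ge> 0\<close> for
  \<open>w \<le> 0\<close>.
\<close>

lemma lin_prod_step_pos_on_nonpos:
  assumes xs: "\<forall>x\<in>set xs. x \<ge> 0" and \<beta>: "\<beta> \<ge> 0" and \<kappa>: "\<kappa> \<ge> 0" and w: "w \<le> 0"
  shows "(1 - \<beta> * w) * poly (lin_prod xs) w + \<kappa> * w * poly (pderiv (lin_prod xs)) w > 0"
proof -
  have "poly (lin_prod xs) w > 0 \<and> w * poly (pderiv (lin_prod xs)) w \<ge> 0"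
    using xs
  proof (induction xs)
    case (Cons x xs)
    have 2: "- (x * w) \<ge> 0"
      using Cons.prems w by (simp add: mult_nonneg_nonpos)
    then have 1: "1 - x * w > 0" by linarith
    have IH: "poly (lin_prod xs) w > 0" "w * poly (pderiv (lin_prod xs)) w \<ge> 0"
      using Cons by simp_all
    have "poly (lin_prod (x # xs)) w = (1 - x * w) * poly (lin_prod xs) w"
      by (simp add: algebra_simps)
    moreover have "w * poly (pderiv (lin_prod (x # xs))) w =
        (1 - x * w) * (w * poly (pderiv (lin_prod xs)) w) + - (x * w) * poly (lin_prod xs) w"
      unfolding lin_prod_simps pderiv_mult by (simp add: pderiv_pCons algebra_simps)
    ultimately show ?case
      using IH 1 2 mult_pos_pos[OF 1 IH(1)] mult_nonneg_nonneg[OF less_imp_le[OF 1] IH(2)]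
        mult_nonneg_nonneg[OF 2 less_imp_le[OF IH(1)]] by linarith
  qed auto
  moreover have "1 - \<beta> * w > 0"
    using mult_nonneg_nonpos[OF \<beta> w] by linarith
  ultimately show ?thesis
    using \<kappa> by (simp add: mult.assoc add_pos_nonneg)
qed

text \<open>
  This closure property is the source of all real-rootedness below.  The case \<open>\<beta> = 0\<close> multiplies
  the \<open>n\<close>-th coefficient by \<open>1 + \<kappa> n\<close>; \<open>\<beta> > 0\<close> is needed for quadratics \<open>Q\<close> without real roots.
\<close>

lemma lin_prod_step:
  assumes xs: "\<forall>x\<in>set xs. x \<ge> 0" and \<beta>: "\<beta> \<ge> 0" and \<kappa>: "\<kappa> \<ge> 0"
  shows "\<exists>ys. (\<forall>y\<in>set ys. y \<ge> 0) \<and>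
     lin_prod ys = [:1, - \<beta>:] * lin_prod xs + [:0, \<kappa>:] * pderiv (lin_prod xs)"
proof -
  let ?p = "lin_prod xs"
  let ?q = "[:1, - \<beta>:] * ?p + [:0, \<kappa>:] * pderiv ?p"
  have q: "poly (cpoly ?q) w = (1 - of_real \<beta> * w) * poly (cpoly ?p) w
         + of_real \<kappa> * w * poly (pderiv (cpoly ?p)) w" for w
    by (simp only: cpoly_add cpoly_mult cpoly_pderiv poly_add poly_mult)
       (simp add: map_poly_pCons algebra_simps)
  have "Im w = 0 \<and> Re w > 0" if w: "poly (cpoly ?q) w = 0" for w
  proof -
    have "\<not> Im w > 0"
      using lin_prod_step_nonzero_upper_half_plane[OF assms] w q by auto
    moreover have "\<not> Im (cnj w) > 0"
    proof -
      have "poly (cpoly ?q) (cnj w) = cnj (poly (cpoly ?q) w)"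
        by (subst poly_cnj_real) (auto simp: coeff_map_poly)
      then have "poly (cpoly ?q) (cnj w) = 0" using w by simp
      then show ?thesis using lin_prod_step_nonzero_upper_half_plane[OF assms, of "cnj w"] q by auto
    qed
    ultimately have im: "Im w = 0" by simp
    then have re: "w = of_real (Re w)" by (simp add: complex_eq_iff)
    have "poly ?q (Re w) = 0"
      using w re by (metis of_real_eq_0_iff poly_cpoly_of_real)
    moreover have "poly ?q t = (1 - \<beta> * t) * poly ?p t + \<kappa> * t * poly (pderiv ?p) t" for t
      by (simp add: algebra_simps)
    ultimately have "\<not> Re w \<le> 0"
      using lin_prod_step_pos_on_nonpos[OF assms, of "Re w"] by (metis less_irrefl)
    with im show ?thesis by simp
  qed
  moreover have "coeff ?q 0 = 1" by (simp add: coeff_mult_0)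
  ultimately show ?thesis
    using splits_into_positive_linear_factors[of ?q] by metis
qed

section \<open>Logarithmic derivatives and power sums\<close>

definition psum :: "real list \<Rightarrow> nat \<Rightarrow> real" where
  "psum xs k = (\<Sum>x\<leftarrow>xs. x ^ k)"

text \<open>
  For \<open>F = \<Prod>j. (1 - x_j w)\<close> the coefficients of this series are the power sums of the \<open>x_j\<close>,
  which is the generating-function form of Newton's identities.
\<close>

definition neg_log_deriv :: "'a :: field fps \<Rightarrow> 'a fps" where
  "neg_log_deriv F = - fps_deriv F / F"

lemma neg_log_deriv_mult_self:
  assumes "fps_nth F 0 \<noteq> 0"
  shows "neg_log_deriv F * F = - fps_deriv F"
proof -
  have "inverse F * F = 1"
    using assms by (rule inverse_mult_eq_1)
  then show ?thesis
    using assms by (simp add: neg_log_deriv_def fps_divide_unit mult.assoc)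
qed

lemma neg_log_deriv_eqI:
  assumes "fps_nth F 0 \<noteq> 0" "S * F = - fps_deriv F"
  shows "neg_log_deriv F = S"
proof -
  have "F \<noteq> 0" using assms(1) by auto
  with assms neg_log_deriv_mult_self[OF assms(1)] show ?thesis
    by (metis mult_right_cancel)
qed

lemma neg_log_deriv_mult:
  fixes F G :: "real fps"
  assumes "fps_nth F 0 \<noteq> 0" "fps_nth G 0 \<noteq> 0"
  shows "neg_log_deriv (F * G) = neg_log_deriv F + neg_log_deriv G"
proof (rule neg_log_deriv_eqI)
  show "(F * G) $ 0 \<noteq> 0" using assms by simp
  have "(neg_log_deriv F + neg_log_deriv G) * (F * G)
    = (neg_log_deriv F * F) * G + (neg_log_deriv G * G) * F"
    by (simp add: algebra_simps)
  also have "\<dots> = - fps_deriv (F * G)"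
    unfolding neg_log_deriv_mult_self[OF assms(1)] neg_log_deriv_mult_self[OF assms(2)]
    by (simp add: algebra_simps)
  finally show "(neg_log_deriv F + neg_log_deriv G) * (F * G) = - fps_deriv (F * G)" .
qed

lemma neg_log_deriv_linear:
  "neg_log_deriv (fps_of_poly [:1, - x:]) = Abs_fps (\<lambda>k. x ^ Suc k :: real)"
proof (rule neg_log_deriv_eqI)
  show "Abs_fps (\<lambda>k. x ^ Suc k) * fps_of_poly [:1, - x:] = - fps_deriv (fps_of_poly [:1, - x:])"
  proof (rule fps_ext)
    fix n
    show "(Abs_fps (\<lambda>k. x ^ Suc k) * fps_of_poly [:1, - x:]) $ n =
        (- fps_deriv (fps_of_poly [:1, - x:])) $ n"
    proof (cases n)
      case 0
      then show ?thesis by (simp add: fps_mult_nth)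
    next
      case (Suc m)
      have 1: "fps_of_poly [:1, - x:] = 1 - fps_const x * fps_X"
        by (simp add: fps_of_poly_pCons)
      show ?thesis unfolding 1 using Suc
        by (simp add: right_diff_distrib mult.assoc[symmetric] mult.commute[of _ "fps_const x"])
    qed
  qed
qed simp

lemma neg_log_deriv_lin_prod:
  "neg_log_deriv (fps_of_poly (lin_prod xs)) = Abs_fps (\<lambda>k. psum xs (Suc k))"
proof (induction xs)
  case Nil
  then show ?case
    by (simp add: neg_log_deriv_def psum_def fps_eq_iff)
next
  case (Cons x xs)
  have "neg_log_deriv (fps_of_poly (lin_prod (x # xs)))
     = neg_log_deriv (fps_of_poly [:1, - x:]) + neg_log_deriv (fps_of_poly (lin_prod xs))"
    unfolding lin_prod_simps fps_of_poly_mult by (rule neg_log_deriv_mult) simp_all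
  also have "\<dots> = Abs_fps (\<lambda>k. psum (x # xs) (Suc k))"
    unfolding Cons.IH neg_log_deriv_linear by (simp add: fps_eq_iff psum_def)
  finally show ?case .
qed

text \<open>
  Newton's recursion.  Since it involves finitely many coefficients of \<open>F\<close>, the coefficients of
  the logarithmic derivative depend continuously on those of \<open>F\<close>.
\<close>

lemma neg_log_deriv_nth:
  assumes "fps_nth F 0 = 1"
  shows "neg_log_deriv F $ n = - of_nat (Suc n) * F $ Suc n - (\<Sum>i<n. neg_log_deriv F $ i * F $ (n - i))"
proof -
  have "(neg_log_deriv F * F) $ n = - of_nat (Suc n) * F $ Suc n"
    using neg_log_deriv_mult_self[of F] assms by (simp add: algebra_simps del: fps_mult_nth)
  also have "(neg_log_deriv F * F) $ n = (\<Sum>i\<le>n. neg_log_deriv F $ i * F $ (n - i))"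
    by (simp add: fps_mult_nth atLeast0AtMost)
  also have "\<dots> = (\<Sum>i<n. neg_log_deriv F $ i * F $ (n - i)) + neg_log_deriv F $ n"
    using assms by (simp add: lessThan_Suc_atMost[symmetric])
  finally show ?thesis by (metis add_diff_cancel_left')
qed

lemma tendsto_neg_log_deriv:
  fixes F :: "real fps"
  assumes lim: "\<And>n. (\<lambda>m. X m $ n) \<longlonglongrightarrow> F $ n" and X: "\<And>m. X m $ 0 = 1"
  shows "(\<lambda>m. neg_log_deriv (X m) $ n) \<longlonglongrightarrow> neg_log_deriv F $ n"
proof -
  have F: "F $ 0 = 1"
    using lim[of 0] X by (simp add: LIMSEQ_const_iff)
  show ?thesis
  proof (induction n rule: less_induct)
    case (less n)
    show ?case
      unfolding neg_log_deriv_nth[OF F, of n] neg_log_deriv_nth[OF X, of _ n]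
      by (intro tendsto_intros lim less.IH) simp
  qed
qed

section \<open>Limits of polynomials with positive roots\<close>

text \<open>
  These are essentially the functions of the Laguerre-Polya class with positive zeros.  Coefficientwise
  convergence suffices, because every consequence is drawn from finitely many coefficients at a time.
\<close>

definition lin_prod_limit :: "real fps \<Rightarrow> bool" where
  "lin_prod_limit F \<longleftrightarrow> (\<exists>X. (\<forall>m. \<forall>x\<in>set (X m). 0 \<le> x) \<and>
     (\<forall>n. (\<lambda>m. coeff (lin_prod (X m)) n) \<longlonglongrightarrow> F $ n))"

lemma lin_prod_limit_nth_0: "lin_prod_limit F \<Longrightarrow> F $ 0 = 1"
  unfolding lin_prod_limit_def by (auto simp: LIMSEQ_const_iff dest!: spec[of _ 0])

lemma lin_prod_limit_step:
  assumes F: "lin_prod_limit F" and "\<beta> \<ge> 0" "\<kappa> \<ge> 0"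
  shows "lin_prod_limit ((1 - fps_const \<beta> * fps_X) * F + fps_const \<kappa> * fps_X * fps_deriv F)"
proof -
  obtain X where X: "\<And>m x. x \<in> set (X m) \<Longrightarrow> 0 \<le> x"
    "\<And>n. (\<lambda>m. coeff (lin_prod (X m)) n) \<longlonglongrightarrow> F $ n"
    using F unfolding lin_prod_limit_def by blast
  let ?T = "\<lambda>p. [:1, - \<beta>:] * p + [:0, \<kappa>:] * pderiv p"
  have "\<forall>m. \<exists>ys. (\<forall>y\<in>set ys. y \<ge> 0) \<and> lin_prod ys = ?T (lin_prod (X m))"
    using X(1) assms(2,3) by (intro allI lin_prod_step) auto
  then obtain Y where Y: "\<And>m. (\<forall>y\<in>set (Y m). y \<ge> 0) \<and> lin_prod (Y m) = ?T (lin_prod (X m))"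
    by metis
  have "(\<lambda>m. coeff (lin_prod (Y m)) n) \<longlonglongrightarrow>
      ((1 - fps_const \<beta> * fps_X) * F + fps_const \<kappa> * fps_X * fps_deriv F) $ n" for n
  proof (cases n)
    case 0
    then show ?thesis using X(2)[of 0] by simp
  next
    case (Suc k)
    have 1: "coeff (lin_prod (Y m)) n = coeff (lin_prod (X m)) n - \<beta> * coeff (lin_prod (X m)) k
        + \<kappa> * (real n * coeff (lin_prod (X m)) n)" for m
      using Y[of m] Suc by (simp add: coeff_pderiv)
    have 2: "((1 - fps_const \<beta> * fps_X) * F + fps_const \<kappa> * fps_X * fps_deriv F) $ n
       = F $ n - \<beta> * F $ k + \<kappa> * (real n * F $ n)"
      using Suc by (simp add: left_diff_distrib mult.assoc)
    show ?thesis
      unfolding 1 2 by (intro tendsto_intros X)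
  qed
  with Y show ?thesis
    unfolding lin_prod_limit_def by blast
qed

text \<open>
  The second claim expresses the monotonicity of \<open>l^p\<close> norms and follows from
  \<open>x \<le> root j (psum xs j)\<close>; the last two sum \<open>x^k (x - t)^2 \<ge> 0\<close>, and compare it with
  \<open>x^(k+1) (x - t)^2\<close> via \<open>x \<le> psum xs 1\<close>.
\<close>

lemma psum_facts:
  assumes xs: "\<forall>x\<in>set xs. x \<ge> 0"
  shows "psum xs k \<ge> 0"
    and "j > 0 \<Longrightarrow> psum xs (Suc k) \<le> root j (psum xs j) * psum xs k"
    and "psum xs (k + 2) - 2 * t * psum xs (k + 1) + t\<^sup>2 * psum xs k \<ge> 0"
    and "psum xs (k + 3) - 2 * t * psum xs (k + 2) + t\<^sup>2 * psum xs (k + 1)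
      \<le> psum xs 1 * (psum xs (k + 2) - 2 * t * psum xs (k + 1) + t\<^sup>2 * psum xs k)"
proof -
  have le: "x ^ j \<le> psum xs j" if "x \<in> set xs" for x j
    unfolding psum_def using that xs
    by (intro member_le_sum_list) (auto)
  show "psum xs k \<ge> 0"
    unfolding psum_def using xs by (intro sum_list_nonneg) auto
  show "psum xs (Suc k) \<le> root j (psum xs j) * psum xs k" if "j > 0"
  proof -
    have "x ^ Suc k \<le> root j (psum xs j) * x ^ k" if x: "x \<in> set xs" for x
    proof -
      have "x = root j (x ^ j)" using xs x \<open>j > 0\<close> by (simp add: real_root_power_cancel)
      also have "\<dots> \<le> root j (psum xs j)" using le[OF x] \<open>j > 0\<close> by simp
      finally show ?thesis using xs x by (simp add: mult_right_mono)
    qed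
    then show ?thesis
      unfolding psum_def sum_list_const_mult[symmetric] by (intro sum_list_mono) auto
  qed
  have quad: "psum xs (k + 2) - 2 * t * psum xs (k + 1) + t\<^sup>2 * psum xs k
     = (\<Sum>x\<leftarrow>xs. x ^ k * (x - t)\<^sup>2)" for k
    unfolding psum_def
    by (simp add: sum_list_const_mult[symmetric] sum_list_addf[symmetric] sum_list_subtractf[symmetric]
        power2_eq_square algebra_simps power_add)
  show "psum xs (k + 2) - 2 * t * psum xs (k + 1) + t\<^sup>2 * psum xs k \<ge> 0"
    unfolding quad using xs by (intro sum_list_nonneg) auto
  have "x ^ (k + 1) * (x - t)\<^sup>2 \<le> psum xs 1 * (x ^ k * (x - t)\<^sup>2)" if x: "x \<in> set xs" for x
  proof -
    have "x * (x ^ k * (x - t)\<^sup>2) \<le> psum xs 1 * (x ^ k * (x - t)\<^sup>2)"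
      using le[OF x, of 1] xs x by (intro mult_right_mono) auto
    then show ?thesis by (simp add: mult.assoc)
  qed
  then have "(\<Sum>x\<leftarrow>xs. x ^ (k + 1) * (x - t)\<^sup>2) \<le> psum xs 1 * (\<Sum>x\<leftarrow>xs. x ^ k * (x - t)\<^sup>2)"
    unfolding sum_list_const_mult[symmetric] by (intro sum_list_mono) auto
  then show "psum xs (k + 3) - 2 * t * psum xs (k + 2) + t\<^sup>2 * psum xs (k + 1)
      \<le> psum xs 1 * (psum xs (k + 2) - 2 * t * psum xs (k + 1) + t\<^sup>2 * psum xs k)"
    using quad[of k] quad[of "k + 1"] by (simp add: numeral_3_eq_3 add.assoc)
qed

section \<open>Inequalities for limits of power sums\<close>

text \<open>
  Closed inequalities between power sums of nonnegative numbers; being closed they survive the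
  passage to a limit.
\<close>

locale power_sum_seq =
  fixes s :: "nat \<Rightarrow> real"
  assumes nonneg: "k \<ge> 1 \<Longrightarrow> s k \<ge> 0"
    and le_root: "k \<ge> 1 \<Longrightarrow> j \<ge> 1 \<Longrightarrow> s (Suc k) \<le> root j (s j) * s k"
    and square_nonneg: "k \<ge> 1 \<Longrightarrow> s (k + 2) - 2 * t * s (k + 1) + t\<^sup>2 * s k \<ge> 0"
    and square_shift: "k \<ge> 1 \<Longrightarrow> s (k + 3) - 2 * t * s (k + 2) + t\<^sup>2 * s (k + 1)
      \<le> s 1 * (s (k + 2) - 2 * t * s (k + 1) + t\<^sup>2 * s k)"

lemma lin_prod_limit_power_sum_seq:
  assumes "lin_prod_limit F"
  shows "power_sum_seq (\<lambda>k. neg_log_deriv F $ (k - 1))"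
proof -
  obtain X where X: "\<And>m. \<forall>x\<in>set (X m). 0 \<le> x"
    "\<And>n. (\<lambda>m. coeff (lin_prod (X m)) n) \<longlonglongrightarrow> F $ n"
    using assms unfolding lin_prod_limit_def by blast
  define s where "s = (\<lambda>k. neg_log_deriv F $ (k - 1))"
  have lim: "(\<lambda>m. psum (X m) k) \<longlonglongrightarrow> s k" if "k \<ge> 1" for k
  proof -
    have "(\<lambda>m. neg_log_deriv (fps_of_poly (lin_prod (X m))) $ (k - 1)) \<longlonglongrightarrow> neg_log_deriv F $ (k - 1)"
      by (intro tendsto_neg_log_deriv) (simp_all add: X)
    with that show ?thesis by (simp add: neg_log_deriv_lin_prod s_def)
  qed
  note I = tendsto_intros tendsto_real_root lim
  have "power_sum_seq s"
  proof
    fix k :: nat assume k: "k \<ge> 1"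
    show "s k \<ge> 0"
      by (rule tendsto_lowerbound[OF lim[OF k]]) (auto intro!: always_eventually psum_facts(1) X)
    show "s (Suc k) \<le> root j (s j) * s k" if j: "j \<ge> 1" for j
    proof (rule tendsto_le[OF sequentially_bot])
      show "(\<lambda>m. root j (psum (X m) j) * psum (X m) k) \<longlonglongrightarrow> root j (s j) * s k"
        using k j by (intro I)
      show "(\<lambda>m. psum (X m) (Suc k)) \<longlonglongrightarrow> s (Suc k)"
        by (intro I) simp
    qed (use j in \<open>auto intro!: always_eventually psum_facts(2) X\<close>)
    fix t
    have 1: "(\<lambda>m. psum (X m) (k + 2) - 2 * t * psum (X m) (k + 1) + t\<^sup>2 * psum (X m) k)
      \<longlonglongrightarrow> s (k + 2) - 2 * t * s (k + 1) + t\<^sup>2 * s k"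
      using k by (intro I) simp_all
    show "s (k + 2) - 2 * t * s (k + 1) + t\<^sup>2 * s k \<ge> 0"
      by (rule tendsto_lowerbound[OF 1]) (use psum_facts(3)[OF X(1)] in auto)
    show "s (k + 3) - 2 * t * s (k + 2) + t\<^sup>2 * s (k + 1)
      \<le> s 1 * (s (k + 2) - 2 * t * s (k + 1) + t\<^sup>2 * s k)"
    proof (rule tendsto_le[OF sequentially_bot])
      show "(\<lambda>m. psum (X m) 1 * (psum (X m) (k + 2) - 2 * t * psum (X m) (k + 1) + t\<^sup>2 * psum (X m) k))
      \<longlonglongrightarrow> s 1 * (s (k + 2) - 2 * t * s (k + 1) + t\<^sup>2 * s k)"
        by (intro tendsto_mult 1 lim) simp
      show "(\<lambda>m. psum (X m) (k + 3) - 2 * t * psum (X m) (k + 2) + t\<^sup>2 * psum (X m) (k + 1))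
      \<longlonglongrightarrow> s (k + 3) - 2 * t * s (k + 2) + t\<^sup>2 * s (k + 1)"
        using k by (intro I) simp_all
    qed (use psum_facts(4)[OF X(1)] in auto)
  qed
  then show ?thesis by (simp add: s_def)
qed

context power_sum_seq
begin

text \<open>
  For power sums of \<open>x_j\<close> and the measure \<open>\<mu>\<close> with mass \<open>x_j^2\<close> at each \<open>x_j\<close>, the hypotheses say \<open>\<integral> (x - t)^2 d\<mu> = 0\<close>, so
  that \<open>\<mu>\<close> is concentrated at \<open>t\<close>.  The axiom \<open>square_shift\<close> replaces the measure in the induction.
\<close>

lemma eq_geometric_of_double_root:
  assumes "s 3 = t * s 2" "s 4 = t * s 3" "k \<ge> 2"
  shows "s (Suc k) = t * s k"
proof -
  have "s (k + 2) - 2 * t * s (k + 1) + t\<^sup>2 * s k = 0 \<and> s (Suc k) = t * s k"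
    using assms(3)
  proof (induction k rule: dec_induct)
    case base
    show ?case using assms(1,2) by (simp add: numeral_eq_Suc power2_eq_square)
  next
    case (step k)
    have "s (Suc k + 2) - 2 * t * s (Suc k + 1) + t\<^sup>2 * s (Suc k) \<le> 0"
    proof -
      have "s (k + 3) - 2 * t * s (k + 2) + t\<^sup>2 * s (k + 1)
          \<le> s 1 * (s (k + 2) - 2 * t * s (k + 1) + t\<^sup>2 * s k)"
        using step.hyps by (intro square_shift) simp
      also have "s (k + 2) - 2 * t * s (k + 1) + t\<^sup>2 * s k = 0"
        by (rule conjunct1[OF step.IH])
      finally show ?thesis by (simp add: numeral_3_eq_3)
    qed
    moreover have "s (Suc k + 2) - 2 * t * s (Suc k + 1) + t\<^sup>2 * s (Suc k) \<ge> 0"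
      using square_nonneg[of "Suc k" t] by simp
    moreover have "s (k + 2) = t * s (k + 1)"
      using step.IH by (auto simp: power2_eq_square algebra_simps)
    ultimately show ?case by simp
  qed
  then show ?thesis ..
qed

lemma log_convex:
  assumes "k \<ge> 1"
  shows "(s (k + 1))\<^sup>2 \<le> s k * s (k + 2)"
proof (cases "s k = 0")
  case True
  then have "s (k + 1) = 0"
    using le_root[OF assms, of 1] nonneg[of "k + 1"] by simp
  with True show ?thesis by simp
next
  case False
  then have pos: "s k > 0" using nonneg[OF assms] by simp
  have "0 \<le> s k * (s (k + 2) - 2 * (s (k + 1) / s k) * s (k + 1) + (s (k + 1) / s k)\<^sup>2 * s k)"
    using square_nonneg[OF assms, of "s (k + 1) / s k"] pos by simp
  also have "\<dots> = s k * s (k + 2) - (s (k + 1))\<^sup>2"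
    using pos by (simp add: field_simps power2_eq_square)
  finally show ?thesis by simp
qed

end

text \<open>
  A geometric tail is the sign of a single value \<open>x_j\<close> in the limit, the case of equality in the
  inequalities above.
\<close>

locale strict_power_sum_seq = power_sum_seq +
  assumes not_geometric: "\<not> (\<exists>t\<ge>0. \<forall>k\<ge>2. s (Suc k) = t * s k)"
begin

text \<open>
  If \<open>(s 3)^2 = s 2 * s 4\<close>, then \<open>t = s 3 / s 2\<close> satisfies \<open>eq_geometric_of_double_root\<close>.
  If \<open>s 4 = (s 2)^2\<close>, the chain \<open>s 4 \<le> sqrt (s 2) * s 3 \<le> (s 2)^2\<close> collapses, which leads back
  to the first equality.
\<close>

lemma s_pos: "k \<ge> 1 \<Longrightarrow> k \<le> 4 \<Longrightarrow> s k > 0"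
  and s4_strict: "s 4 < (s 2)\<^sup>2"
  and s3_strict: "(s 3)\<^sup>2 < s 2 * s 4"
proof -
  have zero: "s (Suc k) = 0" if "k \<ge> 1" "s k = 0" for k
    using le_root[OF that(1), of 1] nonneg[of "Suc k"] that by simp
  have s2: "s 2 > 0"
  proof (rule ccontr)
    assume "\<not> s 2 > 0"
    then have "s 2 = 0" using nonneg[of 2] by simp
    have "s k = 0" if "k \<ge> 2" for k
      using that by (induction k rule: dec_induct) (use \<open>s 2 = 0\<close> zero in auto)
    then have "\<exists>t\<ge>0. \<forall>k\<ge>2. s (Suc k) = t * s k"
      by (intro exI[of _ 0]) auto
    with not_geometric show False by simp
  qed
  have le: "(s 3)\<^sup>2 \<le> s 2 * s 4"
    using log_convex[of 2] by simp
  show strict: "(s 3)\<^sup>2 < s 2 * s 4"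
  proof (rule ccontr)
    assume "\<not> (s 3)\<^sup>2 < s 2 * s 4"
    with le have eq: "(s 3)\<^sup>2 = s 2 * s 4" by simp
    define t where "t = s 3 / s 2"
    have "s 3 = t * s 2" "s 4 = t * s 3" "t \<ge> 0"
      using s2 eq nonneg[of 3] by (simp_all add: t_def field_simps power2_eq_square)
    with not_geometric show False
      using eq_geometric_of_double_root[of t] by blast
  qed
  then have "s 2 * s 4 > 0"
    by (meson le_less_trans zero_le_power2)
  then have s4: "s 4 > 0"
    using s2 by (simp add: zero_less_mult_iff)
  have s1: "s 1 \<noteq> 0" using zero[of 1] s2 by (auto simp: numeral_2_eq_2)
  have s3: "s 3 \<noteq> 0" using zero[of 3] s4 by auto
  have r: "s 3 \<le> sqrt (s 2) * s 2" "s 4 \<le> sqrt (s 2) * s 3"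
    using le_root[of 2 2] le_root[of 3 2] by (simp_all add: sqrt_def numeral_eq_Suc)
  show "s k > 0" if "k \<ge> 1" "k \<le> 4" for k
  proof -
    from that have "k = 1 \<or> k = 2 \<or> k = 3 \<or> k = 4" by auto
    then show ?thesis using s1 s2 s3 s4 nonneg[of k] that by auto
  qed
  show "s 4 < (s 2)\<^sup>2"
  proof -
    have "sqrt (s 2) * s 3 \<le> sqrt (s 2) * (sqrt (s 2) * s 2)"
      using r(1) s2 by (intro mult_left_mono) auto
    also have "\<dots> = (s 2)\<^sup>2" using s2 by (simp add: power2_eq_square flip: mult.assoc)
    finally have a: "sqrt (s 2) * s 3 \<le> (s 2)\<^sup>2" .
    have "s 4 \<noteq> (s 2)\<^sup>2"
    proof
      assume eq: "s 4 = (s 2)\<^sup>2"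
      with r(2) a have "sqrt (s 2) * s 3 = (s 2)\<^sup>2" by linarith
      then have "(sqrt (s 2) * s 3)\<^sup>2 = ((s 2)\<^sup>2)\<^sup>2" by simp
      then have "s 2 * (s 3)\<^sup>2 = s 2 * (s 2 * s 4)"
        using s2 eq by (simp add: power_mult_distrib) (simp add: power2_eq_square power4_eq_xxxx)
      with s2 strict show False by simp
    qed
    with a r(2) show ?thesis by linarith
  qed
qed

lemma le_power: "k \<ge> 4 \<Longrightarrow> s k \<le> root 4 (s 4) ^ k"
proof (induction k rule: dec_induct)
  case base
  then show ?case using nonneg[of 4] by simp
next
  case (step k)
  have "s (Suc k) \<le> root 4 (s 4) * s k"
    using step.hyps by (intro le_root) auto
  also have "\<dots> \<le> root 4 (s 4) * root 4 (s 4) ^ k"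
    using step.IH nonneg[of 4] by (intro mult_left_mono) auto
  finally show ?case by simp
qed

lemma ge_power: "k \<ge> 3 \<Longrightarrow> s k > 0 \<and> s (Suc k) \<ge> s 4 / s 3 * s k"
proof (induction k rule: dec_induct)
  case base
  then show ?case using s_pos[of 3] by simp
next
  case (step k)
  let ?r = "s 4 / s 3"
  have r: "?r > 0" using s_pos[of 3] s_pos[of 4] by simp
  have pos: "s (Suc k) > 0"
    using step.IH mult_pos_pos[OF r, of "s k"] by linarith
  have "?r * s (Suc k) * s k \<le> s (Suc k) * s (Suc k)"
    using mult_right_mono[OF conjunct2[OF step.IH] less_imp_le[OF pos]] by (simp add: mult_ac)
  also have "\<dots> \<le> s (Suc (Suc k)) * s k"
    using log_convex[of k] step.hyps by (simp add: power2_eq_square mult.commute)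
  finally have "?r * s (Suc k) \<le> s (Suc (Suc k))"
    by (rule mult_right_le_imp_le) (use step.IH in simp)
  with pos show ?case by simp
qed

end

section \<open>The first zero of an entire series\<close>

text \<open>
  Series have real coefficients, so that signs and limits are those of real numbers; the embedding
  makes their values on complex discs available.
\<close>

definition cfps :: "real fps \<Rightarrow> complex fps" where
  "cfps F = Abs_fps (\<lambda>n. complex_of_real (F $ n))"

lemma cfps_nth [simp]: "cfps F $ n = complex_of_real (F $ n)"
  by (simp add: cfps_def)

lemma cfps_add: "cfps (F + G) = cfps F + cfps G"
  and cfps_uminus: "cfps (- F) = - cfps F"
  and cfps_mult: "cfps (F * G) = cfps F * cfps G"
  and cfps_deriv: "cfps (fps_deriv F) = fps_deriv (cfps F)"
  and cfps_const: "cfps (fps_const c) = fps_const (complex_of_real c)"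
  and cfps_X: "cfps fps_X = fps_X"
  by (simp_all add: fps_eq_iff fps_mult_nth fps_X_def)

lemma cfps_neg_log_deriv:
  assumes "F $ 0 \<noteq> 0"
  shows "cfps (neg_log_deriv F) = neg_log_deriv (cfps F)"
  by (rule neg_log_deriv_eqI[symmetric])
     (use assms neg_log_deriv_mult_self[OF assms] in
       \<open>simp_all flip: cfps_mult cfps_deriv cfps_uminus\<close>)

lemma fps_conv_radius_cfps [simp]: "fps_conv_radius (cfps F) = fps_conv_radius F"
  by (simp add: fps_conv_radius_def conv_radius_def)

lemma eval_cfps_of_real:
  assumes "ereal \<bar>x\<bar> < fps_conv_radius F"
  shows "eval_fps (cfps F) (of_real x) = complex_of_real (eval_fps F x)"
proof -
  have "(\<lambda>n. F $ n * x ^ n) sums eval_fps F x"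
    using assms by (intro sums_eval_fps) simp
  then have "(\<lambda>n. complex_of_real (F $ n * x ^ n)) sums of_real (eval_fps F x)"
    by (rule sums_of_real)
  then have "(\<lambda>n. cfps F $ n * of_real x ^ n) sums of_real (eval_fps F x)"
    by simp
  then show ?thesis
    unfolding eval_fps_def by (rule sums_unique[symmetric])
qed

lemma norm_eval_cfps_le:
  assumes "\<And>n. S $ n \<ge> 0" "ereal (norm w) < fps_conv_radius S"
  shows "norm (eval_fps (cfps S) w) \<le> eval_fps S (norm w)"
proof -
  have 1: "summable (\<lambda>n. norm (cfps S $ n * w ^ n))"
    using norm_summable_fps[of w "cfps S"] assms(2) by simp
  have "norm (eval_fps (cfps S) w) \<le> (\<Sum>n. norm (cfps S $ n * w ^ n))"
    unfolding eval_fps_def by (rule summable_norm[OF 1])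
  also have "\<dots> = eval_fps S (norm w)"
    unfolding eval_fps_def using assms(1) by (simp add: norm_mult norm_power)
  finally show ?thesis .
qed

text \<open>
  The operator \<open>\<mu> + \<kappa> w d/dw\<close>, which acts diagonally on coefficients.
\<close>

definition euler_op :: "'a \<Rightarrow> 'a \<Rightarrow> 'a :: comm_ring_1 fps \<Rightarrow> 'a fps" where
  "euler_op \<mu> \<kappa> F = fps_const \<mu> * F + fps_const \<kappa> * fps_X * fps_deriv F"

lemma euler_op_nth: "euler_op \<mu> \<kappa> F $ n = (\<mu> + \<kappa> * of_nat n) * F $ n"
  by (cases n) (simp_all add: euler_op_def mult.assoc distrib_right)

lemma cfps_euler_op: "cfps (euler_op \<mu> \<kappa> F) = euler_op (of_real \<mu>) (of_real \<kappa>) (cfps F)"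
  by (simp add: euler_op_def cfps_add cfps_mult cfps_deriv cfps_const cfps_X)

lemma
  fixes F :: "'a :: {banach, real_normed_field} fps"
  assumes F: "fps_conv_radius F = \<infinity>"
  shows fps_conv_radius_euler_op: "fps_conv_radius (euler_op \<mu> \<kappa> F) = \<infinity>"
    and eval_euler_op: "eval_fps (euler_op \<mu> \<kappa> F) w = \<mu> * eval_fps F w + \<kappa> * w * eval_fps (fps_deriv F) w"
proof -
  have 1: "fps_conv_radius (fps_deriv F) = \<infinity>"
    using fps_conv_radius_deriv[of F] F by simp
  have 2: "fps_conv_radius (fps_const \<kappa> * fps_X) = \<infinity>"
    using fps_conv_radius_mult[of "fps_const \<kappa>" fps_X] by simp
  have 3: "fps_conv_radius (fps_const \<kappa> * fps_X * fps_deriv F) = \<infinity>"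
    using fps_conv_radius_mult[of "fps_const \<kappa> * fps_X" "fps_deriv F"] 1 2 by simp
  have 4: "fps_conv_radius (fps_const \<mu> * F) = \<infinity>"
    using fps_conv_radius_mult[of "fps_const \<mu>" F] F by simp
  show "fps_conv_radius (euler_op \<mu> \<kappa> F) = \<infinity>"
    using fps_conv_radius_add[of "fps_const \<mu> * F" "fps_const \<kappa> * fps_X * fps_deriv F"] 3 4
    by (simp add: euler_op_def)
  show "eval_fps (euler_op \<mu> \<kappa> F) w = \<mu> * eval_fps F w + \<kappa> * w * eval_fps (fps_deriv F) w"
    unfolding euler_op_def using 1 2 3 4 F by (simp add: eval_fps_add eval_fps_mult)
qed

text \<open>
  If \<open>P\<close> is a primitive of \<open>- F' / F\<close> on the disc, then \<open>F exp P\<close> has derivative \<open>0\<close>, so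
  \<open>F\<close> is a nonzero constant times \<open>exp (- P)\<close>.  With the converse below, the radius of
  convergence of \<open>- F' / F\<close> is the modulus of the first zero of \<open>F\<close>.
\<close>

lemma eval_fps_nonzero_of_log_deriv_converges:
  fixes F :: "complex fps"
  assumes F: "F $ 0 = 1" "fps_conv_radius F = \<infinity>"
    and w: "ereal (norm w) < fps_conv_radius (neg_log_deriv F)"
  shows "eval_fps F w \<noteq> 0"
proof -
  let ?S = "neg_log_deriv F"
  obtain r where r: "norm w < r" "ereal r < fps_conv_radius ?S"
    using ereal_dense2[OF w] by auto
  have "eval_fps ?S holomorphic_on ball 0 r"
    by (rule holomorphic_on_eval_fps)
       (use less_trans[OF _ r(2)] in auto)
  then obtain P where P: "\<And>z. z \<in> ball 0 r \<Longrightarrow> (P has_field_derivative eval_fps ?S z) (at z within ball 0 r)"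
    using holomorphic_convex_primitive'[OF convex_ball open_ball] by blast
  have 0: "((\<lambda>z. eval_fps F z * exp (P z)) has_field_derivative 0) (at z within ball 0 r)"
    if z: "z \<in> ball 0 r" for z
  proof -
    have zS: "ereal (norm z) < fps_conv_radius ?S"
      using less_trans[OF _ r(2), of "ereal (norm z)"] z by simp
    have "eval_fps ?S z * eval_fps F z = eval_fps (?S * F) z"
      using zS F by (simp add: eval_fps_mult)
    also have "\<dots> = - eval_fps (fps_deriv F) z"
    proof -
      have "ereal (norm z) < fps_conv_radius (fps_deriv F)"
        using fps_conv_radius_deriv[of F] F by simp
      then show ?thesis
        using F(1) by (simp add: neg_log_deriv_mult_self eval_fps_minus)
    qed
    finally have eq: "eval_fps ?S z * eval_fps F z = - eval_fps (fps_deriv F) z" .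
    have "((\<lambda>z. eval_fps F z * exp (P z)) has_field_derivative
      (eval_fps F z * (exp (P z) * eval_fps ?S z) + eval_fps (fps_deriv F) z * exp (P z))) (at z within ball 0 r)"
      using F by (intro DERIV_mult' has_field_derivative_eval_fps DERIV_chain2[OF DERIV_exp] P z) simp
    also have "eval_fps F z * (exp (P z) * eval_fps ?S z) + eval_fps (fps_deriv F) z * exp (P z)
        = exp (P z) * (eval_fps ?S z * eval_fps F z + eval_fps (fps_deriv F) z)"
      by (simp add: algebra_simps)
    also have "\<dots> = 0" unfolding eq by simp
    finally show ?thesis .
  qed
  obtain c where c: "\<And>z. z \<in> ball 0 r \<Longrightarrow> eval_fps F z * exp (P z) = c"
    using has_field_derivative_zero_constant[OF convex_ball 0] by blast
  have "0 \<in> ball 0 r" using r(1) norm_ge_zero[of w] by (simp del: norm_ge_zero)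
  from c[OF this] have "c = exp (P 0)" using F(1) by (simp add: eval_fps_at_0)
  with c[of w] r(1) show ?thesis by auto
qed

lemma log_deriv_converges_of_eval_fps_nonzero:
  fixes F :: "complex fps"
  assumes F: "F $ 0 = 1" "fps_conv_radius F = \<infinity>"
    and nz: "\<And>w. w \<in> ball 0 r \<Longrightarrow> eval_fps F w \<noteq> 0"
  shows "ereal r \<le> fps_conv_radius (neg_log_deriv F)"
proof -
  have 1: "ereal r \<le> fps_conv_radius (inverse F)"
    using fps_conv_radius_inverse[of "ereal r" F] nz F by simp
  have 2: "fps_conv_radius (fps_deriv F) = \<infinity>"
    using fps_conv_radius_deriv[of F] F by simp
  have "neg_log_deriv F = - fps_deriv F * inverse F"
    unfolding neg_log_deriv_def using F by (simp add: fps_divide_unit)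
  then show ?thesis
    using fps_conv_radius_mult[of "- fps_deriv F" "inverse F"] 1 2
    by (metis fps_conv_radius_uminus min_PInf order_trans)
qed

lemma neg_log_deriv_nonneg:
  fixes U :: "real fps"
  assumes "U $ 0 = 1" "\<And>k. k \<ge> 1 \<Longrightarrow> U $ k \<le> 0"
  shows "neg_log_deriv U $ n \<ge> 0"
proof (induction n rule: less_induct)
  case (less n)
  have "(\<Sum>i<n. neg_log_deriv U $ i * U $ (n - i)) \<le> 0"
    by (intro sum_nonpos mult_nonneg_nonpos less.IH assms) auto
  moreover have "- real (Suc n) * U $ Suc n \<ge> 0"
    using assms(2)[of "Suc n"] by (intro mult_nonpos_nonpos) simp_all
  ultimately show ?case
    unfolding neg_log_deriv_nth[OF assms(1), of n] by simp
qed

lemma fps_conv_radius_mono: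
  fixes S T :: "real fps"
  assumes "\<And>n. 0 \<le> T $ n" "\<And>n. T $ n \<le> S $ n"
  shows "fps_conv_radius S \<le> fps_conv_radius T"
  unfolding fps_conv_radius_def
proof (rule conv_radius_geI_ex')
  fix r assume r: "0 < r" "ereal r < conv_radius (fps_nth S)"
  have "summable (\<lambda>n. S $ n * r ^ n)"
    using r by (intro summable_in_conv_radius) simp
  then show "summable (\<lambda>n. T $ n * of_real r ^ n)"
    by (rule summable_comparison_test_ev[rotated])
       (use r assms in \<open>auto intro!: always_eventually mult_right_mono simp: abs_mult\<close>)
qed

lemma eval_fps_pos_of_nonzero:
  fixes F :: "real fps"
  assumes F: "F $ 0 = 1" "fps_conv_radius F = \<infinity>" and x: "x \<ge> 0"
    and nz: "\<And>y. 0 \<le> y \<Longrightarrow> y \<le> x \<Longrightarrow> eval_fps F y \<noteq> 0"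
  shows "eval_fps F x > 0"
proof (rule ccontr)
  assume "\<not> eval_fps F x > 0"
  moreover have "continuous_on {0..x} (eval_fps F)"
    using F by (intro continuous_on_eval_fps') (auto simp: in_eball_iff)
  ultimately have "\<exists>y. 0 \<le> y \<and> y \<le> x \<and> eval_fps F y = 0"
    using F x by (intro IVT2') (simp_all add: eval_fps_at_0)
  with nz show False by blast
qed

text \<open>
  With \<open>T = - G' / G\<close> one has \<open>F = G * (1 - \<sigma> w T)\<close>.  Taking logarithmic derivatives,
  \<open>- F' / F - T\<close> is that of \<open>1 - \<sigma> w T\<close> and has nonnegative coefficients, as \<open>T\<close> has.  Hence
  \<open>T\<close> converges wherever \<open>- F' / F\<close> does, \<open>G\<close> has no zero before the first zero of \<open>F\<close>, and
  \<open>Re (F w / G w) = Re (1 - \<sigma> w T w) \<ge> 1 - \<sigma> \<bar>w\<bar> T \<bar>w\<bar> = F \<bar>w\<bar> / G \<bar>w\<bar>\<close>, which stays positive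
  before that zero.  Conversely \<open>F\<close> cannot vanish where the real part is positive.
\<close>

lemma convexity_condition_iff:
  fixes G :: "real fps" and \<sigma> :: real
  assumes G: "G $ 0 = 1" "fps_conv_radius G = \<infinity>"
    and pos: "\<And>n. neg_log_deriv G $ n \<ge> 0"
    and \<sigma>: "\<sigma> \<ge> 0"
  shows "(\<forall>w\<in>ball 0 r. eval_fps (cfps G) w \<noteq> 0 \<and>
           Re (1 + of_real \<sigma> * w * eval_fps (fps_deriv (cfps G)) w / eval_fps (cfps G) w) > 0)
     \<longleftrightarrow> ereal r \<le> fps_conv_radius (neg_log_deriv (euler_op 1 \<sigma> G))"
proof -
  define F where "F = euler_op 1 \<sigma> G"
  define T where "T = neg_log_deriv G"
  define U where "U = 1 - fps_const \<sigma> * fps_X * T"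
  have dG: "fps_deriv G = - (T * G)"
    using neg_log_deriv_mult_self[of G] G by (simp add: T_def)
  have FGU: "F = G * U"
    unfolding F_def euler_op_def U_def dG by (simp add: algebra_simps)
  have U0: "U $ 0 = 1"
    by (simp add: U_def mult.assoc)
  have "U $ k \<le> 0" if "k \<ge> 1" for k
    using that \<sigma> pos by (cases k) (simp_all add: U_def T_def mult.assoc)
  then have "neg_log_deriv U $ n \<ge> 0" for n
    using U0 by (intro neg_log_deriv_nonneg)
  moreover have NF: "neg_log_deriv F = T + neg_log_deriv U"
    unfolding FGU T_def using G U0 by (intro neg_log_deriv_mult) simp_all
  ultimately have TF: "fps_conv_radius (neg_log_deriv F) \<le> fps_conv_radius T"
    using pos by (intro fps_conv_radius_mono) (simp_all add: T_def)
  have F0: "F $ 0 = 1"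
    by (simp add: F_def euler_op_nth G)
  have rF: "fps_conv_radius F = \<infinity>"
    unfolding F_def using G by (intro fps_conv_radius_euler_op)
  have evF: "eval_fps (cfps F) w = eval_fps (cfps G) w + of_real \<sigma> * w * eval_fps (fps_deriv (cfps G)) w" for w
    using G by (simp add: F_def cfps_euler_op eval_euler_op)
  show ?thesis
    unfolding F_def[symmetric]
  proof (intro iffI ballI)
    assume *: "\<forall>w\<in>ball 0 r. eval_fps (cfps G) w \<noteq> 0 \<and>
           Re (1 + of_real \<sigma> * w * eval_fps (fps_deriv (cfps G)) w / eval_fps (cfps G) w) > 0"
    have "eval_fps (cfps F) w \<noteq> 0" if "w \<in> ball 0 r" for w
    proof -
      have nz: "eval_fps (cfps G) w \<noteq> 0" using * that by blast
      have "Re (1 + of_real \<sigma> * w * eval_fps (fps_deriv (cfps G)) w / eval_fps (cfps G) w) > 0"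
        using * that by blast
      also have "1 + of_real \<sigma> * w * eval_fps (fps_deriv (cfps G)) w / eval_fps (cfps G) w
         = eval_fps (cfps F) w / eval_fps (cfps G) w"
        unfolding evF using nz by (simp add: field_simps)
      finally show ?thesis by auto
    qed
    then have "ereal r \<le> fps_conv_radius (neg_log_deriv (cfps F))"
      using F0 rF by (intro log_deriv_converges_of_eval_fps_nonzero) simp_all
    then show "ereal r \<le> fps_conv_radius (neg_log_deriv F)"
      using F0 by (simp flip: cfps_neg_log_deriv)
  next
    fix w :: complex
    assume r: "ereal r \<le> fps_conv_radius (neg_log_deriv F)" and w: "w \<in> ball 0 r"
    have wF: "ereal (norm w) < fps_conv_radius (neg_log_deriv F)"
      using less_le_trans[OF _ r, of "ereal (norm w)"] w by simp
    have nzG: "eval_fps (cfps G) z \<noteq> 0" if "norm z \<le> norm w" for z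
    proof (rule eval_fps_nonzero_of_log_deriv_converges)
      have "ereal (norm z) < fps_conv_radius (neg_log_deriv G)"
        using that wF TF by (simp add: T_def) (meson ereal_less_eq(3) le_less_trans less_le_trans)
      then show "ereal (norm z) < fps_conv_radius (neg_log_deriv (cfps G))"
        using G by (simp flip: cfps_neg_log_deriv)
    qed (use G in simp_all)
    have nzF: "eval_fps (cfps F) z \<noteq> 0" if "norm z \<le> norm w" for z
    proof (rule eval_fps_nonzero_of_log_deriv_converges)
      have "ereal (norm z) < fps_conv_radius (neg_log_deriv F)"
        using that wF by (meson ereal_less_eq(3) le_less_trans less_le_trans)
      then show "ereal (norm z) < fps_conv_radius (neg_log_deriv (cfps F))"
        using F0 by (simp flip: cfps_neg_log_deriv)
    qed (use F0 rF in simp_all)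
    let ?x = "norm w"
    have wT: "ereal ?x < fps_conv_radius T" using wF TF by (rule less_le_trans)
    have posG: "eval_fps G ?x > 0"
    proof (rule eval_fps_pos_of_nonzero)
      fix y assume y: "0 \<le> y" "y \<le> ?x"
      have "eval_fps (cfps G) (of_real y) \<noteq> 0" using y by (intro nzG) simp
      then show "eval_fps G y \<noteq> 0" using G eval_cfps_of_real[of y G] by auto
    qed (use G in simp_all)
    have posF: "eval_fps F ?x > 0"
    proof (rule eval_fps_pos_of_nonzero)
      fix y assume y: "0 \<le> y" "y \<le> ?x"
      have "eval_fps (cfps F) (of_real y) \<noteq> 0" using y by (intro nzF) simp
      then show "eval_fps F y \<noteq> 0" using rF eval_cfps_of_real[of y F] by auto
    qed (use F0 rF in simp_all)
    have dlog: "eval_fps (fps_deriv (cfps G)) z = - eval_fps (cfps T) z * eval_fps (cfps G) z"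
      if "ereal (norm z) < fps_conv_radius T" for z
    proof -
      have "fps_deriv (cfps G) = - (cfps T * cfps G)"
        using dG by (simp flip: cfps_mult cfps_deriv cfps_uminus)
      moreover have "ereal (norm z) < fps_conv_radius (cfps T * cfps G)"
        using fps_conv_radius_mult[of "cfps T" "cfps G"] that G by (simp add: less_le_trans)
      ultimately show ?thesis
        using that G by (simp add: eval_fps_minus eval_fps_mult)
    qed
    have "complex_of_real (eval_fps F ?x) = of_real (eval_fps G ?x * (1 - \<sigma> * ?x * eval_fps T ?x))"
    proof -
      have "complex_of_real (eval_fps F ?x) = eval_fps (cfps F) (of_real ?x)"
        using rF by (simp add: eval_cfps_of_real)
      also have "\<dots> = eval_fps (cfps G) (of_real ?x) * (1 - of_real \<sigma> * of_real ?x * eval_fps (cfps T) (of_real ?x))"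
        unfolding evF using wT by (subst dlog) (simp_all add: algebra_simps)
      also have "\<dots> = of_real (eval_fps G ?x * (1 - \<sigma> * ?x * eval_fps T ?x))"
        using wT G by (simp add: eval_cfps_of_real)
      finally show ?thesis .
    qed
    then have "eval_fps F ?x = eval_fps G ?x * (1 - \<sigma> * ?x * eval_fps T ?x)"
      by (simp only: of_real_eq_iff)
    with posF posG have q: "1 - \<sigma> * ?x * eval_fps T ?x > 0"
      by (simp add: zero_less_mult_iff)
    have "Re (of_real \<sigma> * w * eval_fps (cfps T) w) \<le> norm (of_real \<sigma> * w * eval_fps (cfps T) w)"
      by (rule complex_Re_le_cmod)
    also have "\<dots> = \<sigma> * ?x * norm (eval_fps (cfps T) w)"
      using \<sigma> by (simp add: norm_mult)
    also have "\<dots> \<le> \<sigma> * ?x * eval_fps T ?x"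
      using \<sigma> wT pos by (intro mult_left_mono norm_eval_cfps_le) (simp_all add: T_def)
    finally have "Re (1 - of_real \<sigma> * w * eval_fps (cfps T) w) > 0"
      using q by simp
    moreover have "1 + of_real \<sigma> * w * eval_fps (fps_deriv (cfps G)) w / eval_fps (cfps G) w
        = 1 - of_real \<sigma> * w * eval_fps (cfps T) w"
      using nzG[of w] dlog[OF wT] by simp
    ultimately show "eval_fps (cfps G) w \<noteq> 0 \<and>
           Re (1 + of_real \<sigma> * w * eval_fps (fps_deriv (cfps G)) w / eval_fps (cfps G) w) > 0"
      using nzG[of w] by simp
  qed
qed

text \<open>
  A geometric tail with ratio \<open>t\<close> means that \<open>- F' / F = (s 1 + d w) / (1 - t w)\<close> with
  \<open>d = s 2 - t s 1\<close>, for instance \<open>F w = (1 - t w) exp (- b w)\<close>.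
  The resulting three-term recursion for the coefficients contradicts their decay: in the limit it
  forces \<open>d = 0\<close>, then \<open>t = 0\<close>, then \<open>s 1 = 0\<close>.
\<close>

lemma strict_power_sum_seq_log_deriv:
  fixes F :: "real fps"
  assumes lim: "lin_prod_limit F"
    and sgn: "\<And>n. (-1) ^ n * F $ n > 0"
    and decay: "(\<lambda>n. real (Suc n) * (F $ Suc n / F $ n)) \<longlonglongrightarrow> 0"
  shows "strict_power_sum_seq (\<lambda>k. neg_log_deriv F $ (k - 1))"
proof -
  define s where "s = (\<lambda>k. neg_log_deriv F $ (k - 1))"
  have F0: "F $ 0 = 1" using lim by (rule lin_prod_limit_nth_0)
  have nz: "F $ n \<noteq> 0" for n using sgn[of n] by auto
  interpret power_sum_seq s
    unfolding s_def by (rule lin_prod_limit_power_sum_seq[OF lim])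
  have "strict_power_sum_seq s"
  proof
    show "\<not> (\<exists>t\<ge>0. \<forall>k\<ge>2. s (Suc k) = t * s k)"
    proof
      assume "\<exists>t\<ge>0. \<forall>k\<ge>2. s (Suc k) = t * s k"
      then obtain t where t: "\<And>k. k \<ge> 2 \<Longrightarrow> s (Suc k) = t * s k" by blast
      define d where "d = s 2 - t * s 1"
      let ?S = "neg_log_deriv F"
      have "(1 - fps_const t * fps_X) * ?S = fps_const (s 1) + fps_const d * fps_X"
      proof (rule fps_ext)
        fix n
        consider "n = 0" | "n = 1" | m where "n = Suc (Suc m)"
          by (metis One_nat_def not0_implies_Suc)
        then show "((1 - fps_const t * fps_X) * ?S) $ n = (fps_const (s 1) + fps_const d * fps_X) $ n"
        proof cases
          case 3
          then show ?thesis using t[of "Suc (Suc m)"]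
            by (simp add: left_diff_distrib mult.assoc s_def)
        qed (simp_all add: left_diff_distrib mult.assoc s_def d_def)
      qed
      then have "(1 - fps_const t * fps_X) * (?S * F) = (fps_const (s 1) + fps_const d * fps_X) * F"
        by (simp only: mult.assoc[symmetric])
      then have "(1 - fps_const t * fps_X) * (- fps_deriv F) = (fps_const (s 1) + fps_const d * fps_X) * F"
        using F0 by (simp add: neg_log_deriv_mult_self)
      then have nth_eq: "((1 - fps_const t * fps_X) * (- fps_deriv F)) $ Suc n
          = ((fps_const (s 1) + fps_const d * fps_X) * F) $ Suc n" for n
        by simp
      have rec: "- real (Suc (Suc n)) * F $ Suc (Suc n) + t * real (Suc n) * F $ Suc n
          = s 1 * F $ Suc n + d * F $ n" for n
        using nth_eq[of n] by (simp add: left_diff_distrib distrib_right mult.assoc)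
      define q where "q n = real (Suc n) * (F $ Suc n / F $ n)" for n
      have q: "q \<longlonglongrightarrow> 0" using decay by (simp add: q_def[abs_def])
      have F_Suc: "F $ Suc n = q n / real (Suc n) * F $ n" for n
        using nz[of n] by (simp add: q_def del: of_nat_Suc)
      have d_eq: "d = (t * real (Suc n) - s 1 - q (Suc n)) * (q n / real (Suc n))" for n
      proof -
        have "d * F $ n = (t * real (Suc n) - s 1 - q (Suc n)) * F $ Suc n"
          using rec[of n] F_Suc[of "Suc n"] by (simp add: algebra_simps del: of_nat_Suc)
        also have "\<dots> = (t * real (Suc n) - s 1 - q (Suc n)) * (q n / real (Suc n)) * F $ n"
          by (subst F_Suc) simp
        finally show ?thesis using nz[of n] by (simp only: mult_right_cancel simp_thms)
      qed
      have q1: "(\<lambda>n. q (Suc n)) \<longlonglongrightarrow> 0"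
        using q by (rule LIMSEQ_Suc)
      have qn: "(\<lambda>n. q n * inverse (real (Suc n))) \<longlonglongrightarrow> 0 * 0"
        by (intro tendsto_mult q LIMSEQ_inverse_real_of_nat)
      have "(\<lambda>n. t * q n - (s 1 + q (Suc n)) * (q n * inverse (real (Suc n)))) \<longlonglongrightarrow> t * 0 - (s 1 + 0) * (0 * 0)"
        by (intro tendsto_intros q q1 qn)
      moreover have "t * q n - (s 1 + q (Suc n)) * (q n * inverse (real (Suc n))) = d" for n
        by (subst d_eq[of n]) (simp add: field_simps)
      ultimately have d0: "d = 0" by (simp add: LIMSEQ_const_iff)
      have q_nz: "q n \<noteq> 0" for n using nz by (simp add: q_def)
      \<comment> \<open>As \<open>d = 0\<close>, one of the two factors in \<open>d_eq\<close> vanishes; it is not \<open>q n\<close>.\<close>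
      have q_eq: "q (Suc n) = t * real (Suc n) - s 1" for n
        using d_eq[of n] d0 q_nz[of n] by simp
      have "(\<lambda>n. q (Suc (Suc n)) - q (Suc n)) \<longlonglongrightarrow> 0 - 0"
        by (intro tendsto_diff q1 LIMSEQ_Suc)
      then have "t = 0"
        unfolding q_eq by (simp add: algebra_simps LIMSEQ_const_iff)
      with q_eq q1 have "s 1 = 0" by (simp add: LIMSEQ_const_iff)
      with \<open>t = 0\<close> q_eq[of 0] q_nz[of 1] show False by simp
    qed
  qed
  then show ?thesis by (simp add: s_def)
qed

text \<open>
  Here \<open>s k \<le> q^k\<close> for \<open>k \<ge> 4\<close> and \<open>q = root 4 (s 4)\<close>, and \<open>s\<close> grows at least with ratio
  \<open>s 4 / s 3\<close>, so that the radius lies between \<open>1 / q\<close> and \<open>s 3 / s 4\<close>.  These are the bounds one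
  index beyond those claimed, which makes room for strict inequality.
\<close>

lemma first_zero_bounds:
  fixes S :: "real fps" and s :: "nat \<Rightarrow> real"
  assumes "strict_power_sum_seq s" and S: "\<And>n. S $ n = s (Suc n)"
  obtains \<rho> where "fps_conv_radius S = ereal \<rho>" "0 < \<rho>"
    "1 / s 1 < \<rho>" "1 / sqrt (s 2) < \<rho>" "\<rho> < s 1 / s 2" "\<rho> < s 2 / s 3"
proof -
  interpret strict_power_sum_seq s by fact
  define q where "q = root 4 (s 4)"
  have pos: "s 1 > 0" "s 2 > 0" "s 3 > 0" "s 4 > 0"
    using s_pos by simp_all
  have q: "q > 0" using pos by (simp add: q_def)
  have lower: "ereal (1 / q) \<le> fps_conv_radius S"
    unfolding fps_conv_radius_def
  proof (rule conv_radius_geI_ex')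
    fix r assume r: "0 < r" "ereal r < ereal (1 / q)"
    then have "q * r < 1" using q by (simp add: field_simps)
    have "summable (\<lambda>n. q * (q * r) ^ n)"
      using \<open>q * r < 1\<close> q r by (intro summable_mult summable_geometric) simp
    then have "summable (\<lambda>n. S $ n * r ^ n)"
    proof (rule summable_comparison_test_ev[rotated])
      show "\<forall>\<^sub>F n in sequentially. norm (S $ n * r ^ n) \<le> q * (q * r) ^ n"
        using eventually_ge_at_top[of 3]
      proof eventually_elim
        case (elim n)
        have "s (Suc n) * r ^ n \<le> q ^ Suc n * r ^ n"
          using le_power[of "Suc n"] elim r by (intro mult_right_mono) (simp_all add: q_def)
        then show ?case
          using nonneg[of "Suc n"] r by (simp add: S power_mult_distrib mult.assoc)
      qed
    qed
    then show "summable (\<lambda>n. S $ n * of_real r ^ n)" by simp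
  qed
  have upper: "fps_conv_radius S \<le> ereal (s 3 / s 4)"
    unfolding fps_conv_radius_def
  proof (rule conv_radius_leI_ex')
    fix r assume r: "0 < r" "ereal r > ereal (s 3 / s 4)"
    then have 1: "s 4 / s 3 * r \<ge> 1" using pos by (simp add: field_simps)
    \<comment> \<open>The terms do not tend to zero, since the ratio of consecutive terms is at least one.\<close>
    have grow: "s 3 * r ^ 2 \<le> S $ n * r ^ n" if "n \<ge> 2" for n
      using that
    proof (induction n rule: dec_induct)
      case base
      show ?case by (simp add: S numeral_3_eq_3)
    next
      case (step n)
      have g: "s (Suc n) > 0" "s 4 / s 3 * s (Suc n) \<le> s (Suc (Suc n))"
        using ge_power[of "Suc n"] step.hyps by simp_all
      have "s 3 * r ^ 2 \<le> 1 * (s (Suc n) * r ^ n)" using step.IH by (simp add: S)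
      also have "\<dots> \<le> (s 4 / s 3 * r) * (s (Suc n) * r ^ n)"
        using 1 g r by (intro mult_right_mono) simp_all
      also have "\<dots> = (s 4 / s 3 * s (Suc n)) * r ^ Suc n" by simp
      also have "\<dots> \<le> s (Suc (Suc n)) * r ^ Suc n"
        using g r by (intro mult_right_mono) simp_all
      finally show ?case by (simp add: S)
    qed
    have "\<not> (\<lambda>n. S $ n * r ^ n) \<longlonglongrightarrow> 0"
    proof
      assume "(\<lambda>n. S $ n * r ^ n) \<longlonglongrightarrow> 0"
      then have "s 3 * r ^ 2 \<le> 0"
        by (rule tendsto_lowerbound)
           (use grow in \<open>auto simp: eventually_sequentially\<close>)
      moreover have "s 3 * r ^ 2 > 0" using pos r by simp
      ultimately show False by simp
    qed
    then show "\<not> summable (\<lambda>n. S $ n * of_real r ^ n)"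
      using summable_LIMSEQ_zero by force
  qed (use pos in simp)
  obtain \<rho> where \<rho>: "fps_conv_radius S = ereal \<rho>"
    using lower upper by (cases "fps_conv_radius S") auto
  have lo: "1 / q \<le> \<rho>" and up: "\<rho> \<le> s 3 / s 4"
    using lower upper \<rho> by simp_all
  have "\<rho> > 0" using lo q by (meson less_le_trans zero_less_divide_1_iff)
  have "root 4 (s 4) < root 4 ((s 2)\<^sup>2)"
    using s4_strict by simp
  also have "\<dots> = root 2 (root 2 ((s 2)\<^sup>2))"
    using real_root_mult_exp[of 2 2 "(s 2)\<^sup>2"] by simp
  also have "\<dots> = sqrt (s 2)"
    using pos by (simp add: sqrt_def[symmetric])
  finally have "q < sqrt (s 2)" by (simp add: q_def)
  then have "1 / sqrt (s 2) < 1 / q" using q pos by (simp add: frac_less2)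
  with lo have r2: "1 / sqrt (s 2) < \<rho>" by simp
  have "s 2 \<le> (s 1)\<^sup>2"
    using le_root[of 1 1] by (simp add: power2_eq_square numeral_2_eq_2)
  then have "sqrt (s 2) \<le> s 1" using pos by (intro real_le_lsqrt) simp_all
  then have "1 / s 1 \<le> 1 / sqrt (s 2)" using pos by (simp add: frac_le)
  with r2 have r1: "1 / s 1 < \<rho>" by simp
  have "s 3 / s 4 < s 2 / s 3"
    using s3_strict pos by (simp add: field_simps power2_eq_square)
  with up have u2: "\<rho> < s 2 / s 3" by simp
  have "s 2 / s 3 \<le> s 1 / s 2"
    using log_convex[of 1] pos by (simp add: field_simps power2_eq_square numeral_3_eq_3 numeral_2_eq_2)
  with u2 have "\<rho> < s 1 / s 2" by simp
  with \<rho> \<open>\<rho> > 0\<close> r1 r2 u2 show ?thesis by (intro that)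
qed

section \<open>The Bessel coefficients\<close>

text \<open>
  The Bessel function is \<open>J_\<nu> z = (z/2)^\<nu> / Gamma (\<nu> + 1)\<close> times this series at \<open>w = z^2\<close>.
\<close>

definition bessel_base :: "real \<Rightarrow> real fps" where
  "bessel_base \<nu> = Abs_fps (\<lambda>n. (-1) ^ n / (fact n * 4 ^ n * pochhammer (\<nu> + 1) n))"

lemma coeff_lin_prod_replicate:
  "coeff (lin_prod (replicate m x)) n = (-1) ^ n * real (m choose n) * x ^ n"
proof (induction m arbitrary: n)
  case 0
  then show ?case by (cases n) simp_all
next
  case (Suc m)
  then show ?case by (cases n) (simp_all add: algebra_simps)
qed

lemma lin_prod_multiplier:
  fixes j :: nat
  assumes "\<forall>x\<in>set xs. x \<ge> 0" "\<And>k. \<kappa> k \<ge> 0"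
  shows "\<exists>ys. (\<forall>y\<in>set ys. y \<ge> 0) \<and>
    (\<forall>n. coeff (lin_prod ys) n = coeff (lin_prod xs) n * (\<Prod>k<j. 1 + \<kappa> k * real n))"
proof (induction j)
  case 0
  then show ?case using assms(1) by auto
next
  case (Suc j)
  then obtain ys where ys: "\<forall>y\<in>set ys. y \<ge> 0"
    "\<And>n. coeff (lin_prod ys) n = coeff (lin_prod xs) n * (\<Prod>k<j. 1 + \<kappa> k * real n)"
    by blast
  obtain zs where zs: "\<forall>z\<in>set zs. z \<ge> 0"
    "lin_prod zs = [:1, - 0:] * lin_prod ys + [:0, \<kappa> j:] * pderiv (lin_prod ys)"
    using lin_prod_step[OF ys(1) order_refl, of "\<kappa> j"] assms(2) by blast
  have "coeff (lin_prod zs) n = (1 + \<kappa> j * real n) * coeff (lin_prod ys) n" for n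
    unfolding zs(2) by (cases n) (simp_all add: coeff_pderiv algebra_simps)
  with zs(1) ys(2) show ?case by (intro exI[of _ zs]) (simp add: mult_ac)
qed

lemma tendsto_prod_shift_div_power:
  "(\<lambda>m. (\<Prod>i<n. real m + c i) / real m ^ n) \<longlonglongrightarrow> 1"
proof -
  have "(\<lambda>m. \<Prod>i<n. 1 + c i * inverse (real m)) \<longlonglongrightarrow> (\<Prod>i<n. 1 + c i * 0)"
    by (intro tendsto_intros lim_inverse_n)
  moreover have "\<forall>\<^sub>F m in sequentially. (\<Prod>i<n. 1 + c i * inverse (real m)) = (\<Prod>i<n. real m + c i) / real m ^ n"
    using eventually_gt_at_top[of 0]
  proof eventually_elim
    case (elim m)
    have "(\<Prod>i<n. real m + c i) / real m ^ n = (\<Prod>i<n. (real m + c i) / real m)"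
      by (simp add: prod_dividef)
    also have "\<dots> = (\<Prod>i<n. 1 + c i * inverse (real m))"
      using elim by (intro prod.cong) (simp_all add: field_simps)
    finally show ?case by simp
  qed
  ultimately show ?thesis by (simp add: tendsto_cong)
qed

text \<open>
  Both sides compare the two factorisations of \<open>pochhammer z (m + n)\<close>.
\<close>

lemma prod_shift_eq_pochhammer:
  assumes z: "z > (0 :: real)"
  shows "(\<Prod>k<m. 1 + 1 / (z + real k) * real n) = pochhammer (z + real m) n / pochhammer z n"
proof -
  have nz: "pochhammer z k > 0" for k using z by (rule pochhammer_pos)
  have "(\<Prod>k<m. 1 + 1 / (z + real k) * real n) = (\<Prod>k<m. (z + real n + real k) / (z + real k))"
  proof (intro prod.cong refl)
    fix k
    have "z + real k > 0" using z by (simp add: add_pos_nonneg)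
    then show "1 + 1 / (z + real k) * real n = (z + real n + real k) / (z + real k)"
      by (simp add: field_simps)
  qed
  also have "\<dots> = pochhammer (z + real n) m / pochhammer z m"
    by (simp add: prod_dividef pochhammer_prod atLeast0LessThan)
  also have "\<dots> = pochhammer (z + real m) n / pochhammer z n"
    using nz[of n] nz[of m] pochhammer_product'[of z n m] pochhammer_product'[of z m n]
    by (simp add: field_simps add.commute)
  finally show ?thesis .
qed

text \<open>
  Applying the factors \<open>1 + n / (\<nu> + 1 + k)\<close> for \<open>k < m\<close> to \<open>(1 - w / (4 m^2))^m\<close> gives
  the coefficients \<open>(m choose n) / m^n\<close> times \<open>(\<nu> + 1 + m)_n / m^n\<close> times
  \<open>(-1)^n / (4^n (\<nu> + 1)_n)\<close>; the first two factors tend to \<open>1 / n!\<close> and \<open>1\<close>.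
\<close>

lemma lin_prod_limit_bessel_base:
  assumes \<nu>: "\<nu> > -1"
  shows "lin_prod_limit (bessel_base \<nu>)"
proof -
  define z where "z = \<nu> + 1"
  have z: "z > 0" using \<nu> by (simp add: z_def)
  define x where "x m = 1 / (4 * (real m)\<^sup>2)" for m
  have "\<forall>m. \<exists>ys. (\<forall>y\<in>set ys. y \<ge> 0) \<and> (\<forall>n. coeff (lin_prod ys) n =
       coeff (lin_prod (replicate m (x m))) n * (\<Prod>k<m. 1 + 1 / (z + real k) * real n))"
    using z by (intro allI lin_prod_multiplier) (auto simp: x_def)
  then obtain Y where Y: "\<And>m. \<forall>y\<in>set (Y m). y \<ge> 0"
    "\<And>m n. coeff (lin_prod (Y m)) n =
       coeff (lin_prod (replicate m (x m))) n * (\<Prod>k<m. 1 + 1 / (z + real k) * real n)"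
    by metis
  have "(\<lambda>m. coeff (lin_prod (Y m)) n) \<longlonglongrightarrow> bessel_base \<nu> $ n" for n
  proof -
    let ?C = "(-1) ^ n / (fact n * 4 ^ n * pochhammer z n) :: real"
    have "(\<lambda>m. ?C * ((\<Prod>i<n. real m + - real i) / real m ^ n) * ((\<Prod>i<n. real m + (z + real i)) / real m ^ n))
       \<longlonglongrightarrow> ?C * 1 * 1"
      by (intro tendsto_intros tendsto_prod_shift_div_power)
    moreover have "\<forall>\<^sub>F m in sequentially.
       ?C * ((\<Prod>i<n. real m + - real i) / real m ^ n) * ((\<Prod>i<n. real m + (z + real i)) / real m ^ n)
        = coeff (lin_prod (Y m)) n"
      using eventually_gt_at_top[of 0]
    proof eventually_elim
      case (elim m)
      have 1: "real (m choose n) = (\<Prod>i<n. real m + - real i) / fact n"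
        by (simp add: binomial_gbinomial gbinomial_prod_rev atLeast0LessThan)
      have 2: "pochhammer (z + real m) n = (\<Prod>i<n. real m + (z + real i))"
        by (simp add: pochhammer_prod atLeast0LessThan add_ac)
      have 3: "x m ^ n = 1 / (4 ^ n * (real m ^ n * real m ^ n))"
        by (simp add: x_def power_divide power_mult_distrib power2_eq_square)
      show ?case
        unfolding Y(2) coeff_lin_prod_replicate prod_shift_eq_pochhammer[OF z] 1 2 3
        by simp
    qed
    ultimately show ?thesis
      by (simp add: tendsto_cong bessel_base_def z_def)
  qed
  with Y(1) show ?thesis unfolding lin_prod_limit_def by blast
qed

lemma lin_prod_limit_euler:
  assumes "lin_prod_limit F" "\<kappa> \<ge> 0"
  shows "lin_prod_limit (euler_op 1 \<kappa> F)"
  using lin_prod_limit_step[OF assms(1) order_refl assms(2)] by (simp add: euler_op_def)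

text \<open>
  Bessel's differential equation on the level of coefficients.
\<close>

lemma bessel_base_Suc:
  assumes "\<nu> > -1"
  shows "bessel_base \<nu> $ n = - (4 * real (Suc n) * (\<nu> + real (Suc n))) * bessel_base \<nu> $ Suc n"
proof -
  have "pochhammer (\<nu> + 1) n > 0" using assms by (intro pochhammer_pos) simp
  moreover have "\<nu> + 1 + real n > 0" using assms by simp
  ultimately show ?thesis
    by (simp add: bessel_base_def pochhammer_Suc divide_simps del: of_nat_Suc)
qed

definition bessel_phi :: "real \<Rightarrow> real \<Rightarrow> real \<Rightarrow> real \<Rightarrow> real fps" where
  "bessel_phi a b c \<nu> = Abs_fps (\<lambda>n. bessel_base \<nu> $ n * (bessel_Q a b c (\<nu> + 2 * real n) / bessel_Q a b c \<nu>))"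

text \<open>
  If \<open>Q\<close> has a real root, it splits into real factors with roots \<open>x < \<nu>\<close>, each of which
  contributes a multiplier \<open>1 + 2 n / (\<nu> - x)\<close>.  Otherwise \<open>a \<ge> 0\<close>, \<open>a < b\<close> and
  \<open>Q \<nu> > 0\<close>; then \<open>Q (\<nu> + 2 n) = Q \<nu> + 2 (b - a) n + 4 a n (\<nu> + n)\<close>, and the differential
  equation trades the quadratic term for a multiplication by \<open>- a w\<close>, which is a step with
  \<open>\<beta> = a / Q \<nu>\<close> and \<open>\<kappa> = 2 (b - a) / Q \<nu>\<close>.
\<close>

lemma bessel_phi_props:
  fixes a b c \<nu> :: real
  assumes abc: "(c = 0 \<and> a \<noteq> b) \<or> (c > 0 \<and> a < b)"
    and \<nu>: "\<nu> \<ge> 0" and Q_nz: "bessel_Q a b c \<nu> \<noteq> 0"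
    and roots: "\<And>x. bessel_Q a b c x = 0 \<Longrightarrow> x < \<nu>"
  shows "lin_prod_limit (bessel_phi a b c \<nu>)"
    and "\<exists>\<alpha>\<ge>0. \<exists>\<beta>\<ge>0. \<forall>n. bessel_Q a b c (\<nu> + 2 * real n) / bessel_Q a b c \<nu> = 1 + \<alpha> * real n + \<beta> * (real n)\<^sup>2"
proof -
  let ?Q = "bessel_Q a b c"
  have base: "lin_prod_limit (bessel_base \<nu>)"
    using \<nu> by (intro lin_prod_limit_bessel_base) simp
  have "lin_prod_limit (bessel_phi a b c \<nu>) \<and>
    (\<exists>\<alpha>\<ge>0. \<exists>\<beta>\<ge>0. \<forall>n. ?Q (\<nu> + 2 * real n) / ?Q \<nu> = 1 + \<alpha> * real n + \<beta> * (real n)\<^sup>2)"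
  proof (cases "\<exists>x. ?Q x = 0")
    case True
    then obtain x where x: "?Q x = 0" by blast
    have "\<exists>\<kappa>1\<ge>0. \<exists>\<kappa>2\<ge>0. \<forall>n. ?Q (\<nu> + 2 * real n) / ?Q \<nu> = (1 + \<kappa>1 * real n) * (1 + \<kappa>2 * real n)"
    proof (cases "a = 0")
      case True
      have Q: "?Q t = b * (t - x)" for t
        using x True by (simp add: bessel_Q_def algebra_simps)
      have "b \<noteq> 0" using Q_nz Q by auto
      then have "?Q (\<nu> + 2 * real n) / ?Q \<nu> = (1 + 2 / (\<nu> - x) * real n) * (1 + 0 * real n)" for n
        using roots[OF x] unfolding Q by (simp add: field_simps)
      then show ?thesis using roots[OF x]
        by (intro exI[of _ "2 / (\<nu> - x)"] exI[of _ 0] conjI) simp_all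
    next
      case False
      define y where "y = (a - b) / a - x"
      have Q: "?Q t = a * (t - x) * (t - y)" for t
      proof -
        have "?Q t = ?Q t - ?Q x" using x by simp
        also have "\<dots> = (t - x) * (a * (t + x) + (b - a))"
          by (simp add: bessel_Q_def algebra_simps)
        also have "a * (t + x) + (b - a) = a * (t - y)"
          using False by (simp add: y_def field_simps)
        finally show ?thesis by (simp add: mult_ac)
      qed
      have xy: "x < \<nu>" "y < \<nu>" using roots[of x] roots[of y] Q by simp_all
      then have "?Q (\<nu> + 2 * real n) / ?Q \<nu> = (1 + 2 / (\<nu> - x) * real n) * (1 + 2 / (\<nu> - y) * real n)" for n
      proof -
        have 1: "1 + 2 / (\<nu> - x) * real n = (\<nu> + 2 * real n - x) / (\<nu> - x)"
          "1 + 2 / (\<nu> - y) * real n = (\<nu> + 2 * real n - y) / (\<nu> - y)"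
          using xy by (simp_all add: field_simps)
        show ?thesis unfolding 1 Q using False by simp
      qed
      then show ?thesis using xy
        by (intro exI[of _ "2 / (\<nu> - x)"] exI[of _ "2 / (\<nu> - y)"] conjI) simp_all
    qed
    then obtain \<kappa>1 \<kappa>2 where \<kappa>: "\<kappa>1 \<ge> 0" "\<kappa>2 \<ge> 0"
      "\<And>n. ?Q (\<nu> + 2 * real n) / ?Q \<nu> = (1 + \<kappa>1 * real n) * (1 + \<kappa>2 * real n)" by blast
    have "euler_op 1 \<kappa>2 (euler_op 1 \<kappa>1 (bessel_base \<nu>)) = bessel_phi a b c \<nu>"
      by (simp add: fps_eq_iff euler_op_nth bessel_phi_def \<kappa>(3))
    with lin_prod_limit_euler[OF lin_prod_limit_euler[OF base \<kappa>(1)] \<kappa>(2)]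
    have "lin_prod_limit (bessel_phi a b c \<nu>)" by simp
    moreover have "?Q (\<nu> + 2 * real n) / ?Q \<nu> = 1 + (\<kappa>1 + \<kappa>2) * real n + (\<kappa>1 * \<kappa>2) * (real n)\<^sup>2" for n
      unfolding \<kappa>(3) by (simp add: algebra_simps power2_eq_square)
    ultimately show ?thesis
      using add_nonneg_nonneg[OF \<kappa>(1,2)] mult_nonneg_nonneg[OF \<kappa>(1,2)] by blast
  next
    case False
    then have "?Q 0 \<noteq> 0" by blast
    then have c: "c > 0" "a < b" using abc by (auto simp: bessel_Q_def)
    have a: "a \<ge> 0"
    proof (rule ccontr)
      assume "\<not> a \<ge> 0"
      then have a: "a < 0" by simp
      define D where "D = (b - a)\<^sup>2 - 4 * a * c"
      have "a * c \<le> 0" using a c by (simp add: mult_nonpos_nonneg)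
      moreover have "D = (b - a)\<^sup>2 - 4 * (a * c)" by (simp add: D_def)
      ultimately have "D \<ge> 0" using zero_le_power2[of "b - a"] by linarith
      define x where "x = (- (b - a) + sqrt D) / (2 * a)"
      have "x * (2 * a) = - (b - a) + sqrt D"
        using nonzero_eq_divide_eq[of "2 * a" x "- (b - a) + sqrt D"] a by (simp only: x_def) auto
      then have "2 * a * x + (b - a) = sqrt D" by (simp only: mult.commute[of x])
      then have "(2 * a * x + (b - a))\<^sup>2 = D" using \<open>D \<ge> 0\<close> by simp
      then have "4 * a * ?Q x = 0"
        by (simp add: bessel_Q_def D_def power2_eq_square algebra_simps)
      with a False show False by simp
    qed
    have Q: "?Q \<nu> > 0"
    proof -
      have "?Q \<nu> = a * \<nu>\<^sup>2 + (b - a) * \<nu> + c"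
        by (simp add: bessel_Q_def power2_eq_square algebra_simps)
      then show ?thesis using a c \<nu> by (simp add: add_nonneg_pos)
    qed
    define \<kappa> where "\<kappa> = 2 * (b - a) / ?Q \<nu>"
    define \<beta> where "\<beta> = a / ?Q \<nu>"
    have nn: "\<kappa> \<ge> 0" "\<beta> \<ge> 0" using a c Q by (simp_all add: \<kappa>_def \<beta>_def)
    have ratio: "?Q (\<nu> + 2 * real n) / ?Q \<nu> = 1 + \<kappa> * real n + \<beta> * (4 * real n * (\<nu> + real n))" for n
    proof -
      have "?Q (\<nu> + 2 * real n) = ?Q \<nu> + 2 * (b - a) * real n + a * (4 * real n * (\<nu> + real n))"
        by (simp add: bessel_Q_def algebra_simps)
      then show ?thesis using Q by (simp add: \<kappa>_def \<beta>_def add_divide_distrib)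
    qed
    have "(1 - fps_const \<beta> * fps_X) * bessel_base \<nu> + fps_const \<kappa> * fps_X * fps_deriv (bessel_base \<nu>)
       = bessel_phi a b c \<nu>"
    proof (rule fps_ext)
      fix n
      show "((1 - fps_const \<beta> * fps_X) * bessel_base \<nu> + fps_const \<kappa> * fps_X * fps_deriv (bessel_base \<nu>)) $ n
         = bessel_phi a b c \<nu> $ n"
      proof (cases n)
        case 0
        then show ?thesis by (simp add: bessel_phi_def Q_nz mult.assoc)
      next
        case (Suc k)
        have base_k: "bessel_base \<nu> $ k = - (4 * real n * (\<nu> + real n)) * bessel_base \<nu> $ n"
          using bessel_base_Suc[of \<nu> k] \<nu> Suc by simp
        have nth: "((1 - fps_const \<beta> * fps_X) * bessel_base \<nu> + fps_const \<kappa> * fps_X * fps_deriv (bessel_base \<nu>)) $ n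
          = bessel_base \<nu> $ n - \<beta> * bessel_base \<nu> $ k + \<kappa> * real n * bessel_base \<nu> $ n"
          using Suc by (simp add: left_diff_distrib mult.assoc)
        show ?thesis
          unfolding nth base_k bessel_phi_def fps_nth_Abs_fps ratio by (simp add: algebra_simps)
      qed
    qed
    with lin_prod_limit_step[OF base nn(2,1)] have "lin_prod_limit (bessel_phi a b c \<nu>)" by simp
    moreover have "?Q (\<nu> + 2 * real n) / ?Q \<nu> = 1 + (\<kappa> + 4 * \<beta> * \<nu>) * real n + (4 * \<beta>) * (real n)\<^sup>2" for n
      unfolding ratio by (simp add: algebra_simps power2_eq_square)
    moreover have "\<kappa> + 4 * \<beta> * \<nu> \<ge> 0" "4 * \<beta> \<ge> 0"
      using nn \<nu> by simp_all
    ultimately show ?thesis by blast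
  qed
  then show "lin_prod_limit (bessel_phi a b c \<nu>)"
    and "\<exists>\<alpha>\<ge>0. \<exists>\<beta>\<ge>0. \<forall>n. ?Q (\<nu> + 2 * real n) / ?Q \<nu> = 1 + \<alpha> * real n + \<beta> * (real n)\<^sup>2"
    by blast+
qed

lemma fps_conv_radius_infinite:
  fixes F :: "real fps"
  assumes nz: "\<And>n. F $ n \<noteq> 0"
    and decay: "(\<lambda>n. real (Suc n) * (F $ Suc n / F $ n)) \<longlonglongrightarrow> 0"
  shows "fps_conv_radius F = \<infinity>"
  unfolding fps_conv_radius_def
proof (rule conv_radius_ratio_limit_ereal)
  show "\<forall>\<^sub>F n in sequentially. F $ n \<noteq> 0" using nz by simp
  have "(\<lambda>n. real (Suc n) * (F $ Suc n / F $ n) * inverse (real (Suc n))) \<longlonglongrightarrow> 0 * 0"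
    by (intro tendsto_mult decay LIMSEQ_inverse_real_of_nat)
  moreover have "real (Suc n) * (F $ Suc n / F $ n) * inverse (real (Suc n)) = F $ Suc n / F $ n" for n
    by (simp add: field_simps del: of_nat_Suc)
  ultimately have "(\<lambda>n. F $ Suc n / F $ n) \<longlonglongrightarrow> 0"
    by (simp only: mult_zero_left)
  then have "(\<lambda>n. \<bar>F $ Suc n / F $ n\<bar>) \<longlonglongrightarrow> 0"
    by (rule tendsto_rabs_zero)
  then have "filterlim (\<lambda>n. inverse \<bar>F $ Suc n / F $ n\<bar>) at_top sequentially"
    by (rule filterlim_inverse_at_top) (use nz in simp)
  then have "filterlim (\<lambda>n. norm (F $ n) / norm (F $ Suc n)) at_top sequentially"
    by (simp add: abs_divide)
  then show "(\<lambda>n. ereal (norm (F $ n) / norm (F $ Suc n))) \<longlonglongrightarrow> \<infinity>"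
    by (simp add: tendsto_PInfty_eq_at_top)
qed

text \<open>
  Each polynomial factor grows at most by a constant factor from \<open>n \<ge> 1\<close> to \<open>n + 1\<close>, while
  \<open>bessel_base_Suc\<close> divides by about \<open>4 n^2\<close>.
\<close>

lemma bessel_coeffs_sign_and_decay:
  assumes \<nu>: "\<nu> \<ge> 0" and \<sigma>: "\<sigma> \<ge> 0" and \<alpha>: "\<alpha> \<ge> 0" and \<beta>: "\<beta> \<ge> 0"
    and F: "\<And>n. F $ n = (1 + \<sigma> * real n) ^ j * (bessel_base \<nu> $ n * (1 + \<alpha> * real n + \<beta> * (real n)\<^sup>2))"
  shows "(-1) ^ n * F $ n > 0"
    and "(\<lambda>n. real (Suc n) * (F $ Suc n / F $ n)) \<longlonglongrightarrow> 0"
proof -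
  define u where "u n = 1 + \<sigma> * real n" for n
  define v where "v n = 1 + \<alpha> * real n + \<beta> * (real n)\<^sup>2" for n
  have u: "u n > 0" for n using \<sigma> by (simp add: u_def add_pos_nonneg)
  have v: "v n > 0" for n using \<alpha> \<beta> by (simp add: v_def add_pos_nonneg)
  have sgn: "(-1) ^ n * bessel_base \<nu> $ n > 0" for n
    using \<nu> pochhammer_pos[of "\<nu> + 1" n] by (simp add: bessel_base_def flip: power_mult_distrib)
  have "(-1) ^ n * F $ n = u n ^ j * ((-1) ^ n * bessel_base \<nu> $ n * v n)" for n
    by (simp add: F u_def v_def)
  moreover have "u n ^ j * ((-1) ^ n * bessel_base \<nu> $ n * v n) > 0" for n
    by (intro mult_pos_pos zero_less_power u v sgn)
  ultimately show "(-1) ^ n * F $ n > 0" for n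
    by (simp only:)
  have bound: "\<bar>real (Suc n) * (F $ Suc n / F $ n)\<bar> \<le> 2 ^ j * inverse (real (Suc n))" if n: "n \<ge> 1" for n
  proof -
    have bn: "bessel_base \<nu> $ n = - (4 * real (Suc n) * (\<nu> + real (Suc n))) * bessel_base \<nu> $ Suc n"
      using \<nu> by (intro bessel_base_Suc) simp
    have nz: "bessel_base \<nu> $ Suc n \<noteq> 0" using sgn[of "Suc n"] by auto
    have pos: "real (Suc n) > 0" "\<nu> + real (Suc n) > 0" using \<nu> by simp_all
    have "real (Suc n) * (F $ Suc n / F $ n) = - ((u (Suc n) / u n) ^ j * (v (Suc n) / (4 * v n)) / (\<nu> + real (Suc n)))"
    proof -
      have "N * (p * (B * y) / (q * (- (4 * N * M) * B * x))) = - ((p / q) * (y / (4 * x)) / M)"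
        if "N \<noteq> 0" "M \<noteq> 0" "B \<noteq> 0" "q \<noteq> 0" "x \<noteq> 0" for N M B p q x y :: real
        using that by (simp add: field_simps)
      from this[of "real (Suc n)" "\<nu> + real (Suc n)" "bessel_base \<nu> $ Suc n" "u n ^ j" "v n" "u (Suc n) ^ j" "v (Suc n)"]
      show ?thesis
        unfolding F u_def[symmetric] v_def[symmetric] bn power_divide
        using nz pos u[of n] v[of n] by auto
    qed
    then have "\<bar>real (Suc n) * (F $ Suc n / F $ n)\<bar> = (u (Suc n) / u n) ^ j * (v (Suc n) / (4 * v n)) / (\<nu> + real (Suc n))"
      using u[of n] u[of "Suc n"] v[of n] v[of "Suc n"] pos by (simp add: abs_mult abs_divide power_abs del: of_nat_Suc)
    also have "\<dots> \<le> 2 ^ j * 1 / (\<nu> + real (Suc n))"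
    proof (intro divide_right_mono mult_mono power_mono)
      have "\<sigma> * 1 \<le> \<sigma> * real n" using \<sigma> n by (intro mult_left_mono) simp_all
      then show "u (Suc n) / u n \<le> 2"
        using u[of n] by (simp add: u_def divide_simps) (simp add: algebra_simps)
      have "\<alpha> * 1 \<le> \<alpha> * real n" using \<alpha> n by (intro mult_left_mono) simp_all
      then have 1: "\<alpha> * real (Suc n) \<le> 4 * (\<alpha> * real n)" using \<alpha> by (simp add: algebra_simps)
      have "(real (Suc n))\<^sup>2 \<le> (2 * real n)\<^sup>2" using n by (intro power_mono) simp_all
      then have "\<beta> * (real (Suc n))\<^sup>2 \<le> \<beta> * (2 * real n)\<^sup>2" using \<beta> by (rule mult_left_mono)
      then have 2: "\<beta> * (real (Suc n))\<^sup>2 \<le> 4 * (\<beta> * (real n)\<^sup>2)" by (simp add: power_mult_distrib)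
      have "v (Suc n) \<le> 4 * v n" using 1 2 by (simp add: v_def del: of_nat_Suc)
      then show "v (Suc n) / (4 * v n) \<le> 1" using v[of n] by simp
    qed (use u[of n] u[of "Suc n"] v[of n] v[of "Suc n"] pos in \<open>simp_all del: of_nat_Suc\<close>)
    also have "\<dots> \<le> 2 ^ j / real (Suc n)"
      using pos \<nu> by (simp add: frac_le del: of_nat_Suc)
    finally show ?thesis by (simp add: divide_inverse)
  qed
  have "(\<lambda>n. 2 ^ j * inverse (real (Suc n))) \<longlonglongrightarrow> 2 ^ j * 0"
    by (intro tendsto_intros LIMSEQ_inverse_real_of_nat)
  then have "(\<lambda>n. 2 ^ j * inverse (real (Suc n))) \<longlonglongrightarrow> 0" by simp
  then show "(\<lambda>n. real (Suc n) * (F $ Suc n / F $ n)) \<longlonglongrightarrow> 0"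
    by (rule Lim_null_comparison[rotated])
       (use bound in \<open>auto simp: eventually_sequentially intro!: exI[of _ 1]\<close>)
qed

section \<open>The normalised functions as power series\<close>

lemma fps_conv_radius_bessel_base:
  assumes "\<nu> \<ge> 0"
  shows "fps_conv_radius (bessel_base \<nu>) = \<infinity>"
proof -
  have *: "bessel_base \<nu> $ n = (1 + 0 * real n) ^ 0 * (bessel_base \<nu> $ n * (1 + 0 * real n + 0 * (real n)\<^sup>2))" for n
    by simp
  note d = bessel_coeffs_sign_and_decay[OF assms order_refl order_refl order_refl *]
  show ?thesis
  proof (rule fps_conv_radius_infinite[OF _ d(2)])
    show "bessel_base \<nu> $ n \<noteq> 0" for n using d(1)[of n] by auto
  qed
qed

text \<open>
  Used twice, for \<open>J'\<close> and \<open>J''\<close>: on functions \<open>z^\<mu> E (z^2)\<close> differentiation is a diagonal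
  operator on the coefficients of \<open>E\<close> combined with \<open>\<mu> \<mapsto> \<mu> - 1\<close>.
\<close>

lemma has_derivative_powr_times_series:
  assumes E: "fps_conv_radius E = \<infinity>" and z: "z \<notin> \<real>\<^sub>\<le>\<^sub>0"
  shows "((\<lambda>z. z powr of_real \<mu> * eval_fps (cfps E) (z\<^sup>2)) has_field_derivative
    z powr of_real (\<mu> - 1) * eval_fps (cfps (euler_op \<mu> 2 E)) (z\<^sup>2)) (at z)"
proof -
  have z0: "z \<noteq> 0" using z by auto
  have "((\<lambda>z. eval_fps (cfps E) (z\<^sup>2)) has_field_derivative
     eval_fps (fps_deriv (cfps E)) (z\<^sup>2) * (2 * z)) (at z)"
    by (rule DERIV_chain2[OF has_field_derivative_eval_fps])
       (use E in \<open>auto intro!: derivative_eq_intros\<close>)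
  then have "((\<lambda>z. z powr of_real \<mu> * eval_fps (cfps E) (z\<^sup>2)) has_field_derivative
     z powr of_real \<mu> * (eval_fps (fps_deriv (cfps E)) (z\<^sup>2) * (2 * z))
       + of_real \<mu> * z powr (of_real \<mu> - 1) * eval_fps (cfps E) (z\<^sup>2)) (at z)"
    by (intro DERIV_mult' has_field_derivative_powr z)
  also have "z powr of_real \<mu> = z powr (of_real \<mu> - 1) * z"
    using z0 by (simp add: powr_diff)
  also have "z powr (of_real \<mu> - 1) * z * (eval_fps (fps_deriv (cfps E)) (z\<^sup>2) * (2 * z))
       + of_real \<mu> * z powr (of_real \<mu> - 1) * eval_fps (cfps E) (z\<^sup>2)
     = z powr of_real (\<mu> - 1) * eval_fps (cfps (euler_op \<mu> 2 E)) (z\<^sup>2)"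
    using E by (simp add: cfps_euler_op eval_euler_op algebra_simps power2_eq_square)
  finally show ?thesis by simp
qed

lemma powr_half:
  fixes z s :: complex
  shows "(z / 2) powr s = z powr s / 2 powr s"
proof -
  have "(of_real (1/2) * z) powr s = of_real (1/2) powr s * z powr s"
    by (rule powr_times_real_left) auto
  moreover have "complex_of_real (1/2) powr s = 1 / 2 powr s"
  proof -
    have "complex_of_real (1/2) powr s * 2 powr s = (complex_of_real (1/2) * 2) powr s"
      by (rule powr_times_real_left[symmetric]) auto
    then show ?thesis by (simp add: field_simps)
  qed
  ultimately show ?thesis by (simp add: field_simps)
qed

lemma bessel_J_eq:
  assumes \<nu>: "\<nu> \<ge> 0" and z: "z \<notin> \<real>\<^sub>\<le>\<^sub>0"
  shows "bessel_J \<nu> z = z powr of_real \<nu> * eval_fps (cfps (bessel_base \<nu>)) (z\<^sup>2) / of_real (2 powr \<nu> * Gamma (\<nu> + 1))"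
proof -
  have z0: "z \<noteq> 0" using z by auto
  have G: "Gamma (\<nu> + 1) > 0" using \<nu> by (intro Gamma_real_pos) simp
  have "(\<lambda>n. cfps (bessel_base \<nu>) $ n * (z\<^sup>2) ^ n) sums eval_fps (cfps (bessel_base \<nu>)) (z\<^sup>2)"
    using fps_conv_radius_bessel_base[OF \<nu>] by (intro sums_eval_fps) simp
  then have "(\<lambda>n. (z powr of_real \<nu> / of_real (2 powr \<nu> * Gamma (\<nu> + 1))) * (cfps (bessel_base \<nu>) $ n * (z\<^sup>2) ^ n)) sums
     ((z powr of_real \<nu> / of_real (2 powr \<nu> * Gamma (\<nu> + 1))) * eval_fps (cfps (bessel_base \<nu>)) (z\<^sup>2))"
    by (rule sums_mult)
  moreover have "(z powr of_real \<nu> / of_real (2 powr \<nu> * Gamma (\<nu> + 1))) * (cfps (bessel_base \<nu>) $ n * (z\<^sup>2) ^ n)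
     = complex_of_real ((-1) ^ n / (fact n * Gamma (real n + \<nu> + 1))) * (z / 2) powr complex_of_real (2 * real n + \<nu>)" for n
  proof -
    have g: "Gamma (real n + \<nu> + 1) = pochhammer (\<nu> + 1) n * Gamma (\<nu> + 1)"
    proof -
      have "\<nu> + 1 \<notin> \<int>\<^sub>\<le>\<^sub>0" using \<nu> nonpos_Ints_nonpos[of "\<nu> + 1"] by auto
      then show ?thesis using pochhammer_Gamma[of "\<nu> + 1" n] G by (simp add: add_ac)
    qed
    have "(z / 2) powr complex_of_real (2 * real n + \<nu>) = (z / 2) powr (of_nat (2 * n) + of_real \<nu>)"
      by simp
    also have "\<dots> = (z / 2) ^ (2 * n) * (z / 2) powr of_real \<nu>"
      using z0 by (simp only: powr_add powr_nat) simp
    also have "(z / 2) ^ (2 * n) = (z\<^sup>2) ^ n / 4 ^ n"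
      by (simp add: power_mult power_divide)
    also have "(z / 2) powr of_real \<nu> = z powr of_real \<nu> / of_real (2 powr \<nu>)"
      using powr_half[of z "of_real \<nu>"] powr_of_real[of 2 \<nu>] by simp
    finally show ?thesis
      unfolding g by (simp add: bessel_base_def mult_ac)
  qed
  ultimately show ?thesis
    unfolding bessel_J_def by (simp add: sums_iff)
qed

text \<open>
  The operator \<open>a z^2 d^2 + b z d + c\<close> multiplies \<open>z^(\<nu> + 2 n)\<close> by
  \<open>a (\<nu> + 2 n) (\<nu> + 2 n - 1) + b (\<nu> + 2 n) + c = Q (\<nu> + 2 n)\<close>.
\<close>

lemma bessel_N_eq:
  assumes \<nu>: "\<nu> \<ge> 0" and z: "z \<notin> \<real>\<^sub>\<le>\<^sub>0" and Q: "bessel_Q a b c \<nu> \<noteq> 0"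
  shows "bessel_N a b c \<nu> z = of_real (bessel_Q a b c \<nu>) * z powr of_real \<nu> *
     eval_fps (cfps (bessel_phi a b c \<nu>)) (z\<^sup>2) / of_real (2 powr \<nu> * Gamma (\<nu> + 1))"
proof -
  define K where "K = complex_of_real (2 powr \<nu> * Gamma (\<nu> + 1))"
  define E where "E = bessel_base \<nu>"
  define E1 where "E1 = euler_op \<nu> 2 E"
  define E2 where "E2 = euler_op (\<nu> - 1) 2 E1"
  have r: "fps_conv_radius E = \<infinity>" "fps_conv_radius E1 = \<infinity>" "fps_conv_radius E2 = \<infinity>"
    using fps_conv_radius_bessel_base[OF \<nu>] by (simp_all add: E_def E1_def E2_def fps_conv_radius_euler_op)
  have z0: "z \<noteq> 0" using z by auto
  have op: "open (- \<real>\<^sub>\<le>\<^sub>0 :: complex set)" by (simp add: open_Compl)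
  have J: "bessel_J \<nu> w = w powr of_real \<nu> * eval_fps (cfps E) (w\<^sup>2) / K" if "w \<notin> \<real>\<^sub>\<le>\<^sub>0" for w
    using bessel_J_eq[OF \<nu>] that by (simp add: K_def E_def)
  have d1: "deriv (bessel_J \<nu>) w = w powr of_real (\<nu> - 1) * eval_fps (cfps E1) (w\<^sup>2) / K"
    if w: "w \<notin> \<real>\<^sub>\<le>\<^sub>0" for w
  proof (rule DERIV_imp_deriv)
    have "((\<lambda>z. z powr of_real \<nu> * eval_fps (cfps E) (z\<^sup>2) / K) has_field_derivative
       w powr of_real (\<nu> - 1) * eval_fps (cfps E1) (w\<^sup>2) / K) (at w)"
      unfolding E1_def by (intro DERIV_cdivide has_derivative_powr_times_series r w)
    then show "(bessel_J \<nu> has_field_derivative w powr of_real (\<nu> - 1) * eval_fps (cfps E1) (w\<^sup>2) / K) (at w)"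
      by (rule has_field_derivative_transform_within_open[OF _ op]) (use w J in auto)
  qed
  have d2: "deriv (deriv (bessel_J \<nu>)) z = z powr of_real (\<nu> - 1 - 1) * eval_fps (cfps E2) (z\<^sup>2) / K"
  proof (rule DERIV_imp_deriv)
    have "((\<lambda>z. z powr of_real (\<nu> - 1) * eval_fps (cfps E1) (z\<^sup>2) / K) has_field_derivative
       z powr of_real (\<nu> - 1 - 1) * eval_fps (cfps E2) (z\<^sup>2) / K) (at z)"
      unfolding E2_def by (intro DERIV_cdivide has_derivative_powr_times_series r z)
    then show "(deriv (bessel_J \<nu>) has_field_derivative z powr of_real (\<nu> - 1 - 1) * eval_fps (cfps E2) (z\<^sup>2) / K) (at z)"
      by (rule has_field_derivative_transform_within_open[OF _ op]) (use z d1 in auto)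
  qed
  have p1: "z * z powr of_real (\<nu> - 1) = z powr of_real \<nu>"
    using z0 by (simp add: powr_diff)
  have p2: "z\<^sup>2 * z powr of_real (\<nu> - 1 - 1) = z powr of_real \<nu>"
    using z0 by (simp add: powr_diff power2_eq_square)
  have "bessel_N a b c \<nu> z = (of_real a * (z\<^sup>2 * z powr of_real (\<nu> - 1 - 1)) * eval_fps (cfps E2) (z\<^sup>2)
      + of_real b * (z * z powr of_real (\<nu> - 1)) * eval_fps (cfps E1) (z\<^sup>2)
      + of_real c * z powr of_real \<nu> * eval_fps (cfps E) (z\<^sup>2)) / K"
    unfolding bessel_N_def d1[OF z] d2 J[OF z] by (simp add: algebra_simps add_divide_distrib)
  also have "\<dots> = z powr of_real \<nu> * (of_real a * eval_fps (cfps E2) (z\<^sup>2) + of_real b * eval_fps (cfps E1) (z\<^sup>2)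
      + of_real c * eval_fps (cfps E) (z\<^sup>2)) / K"
    unfolding p1 p2 by (simp add: algebra_simps)
  also have "of_real a * eval_fps (cfps E2) (z\<^sup>2) + of_real b * eval_fps (cfps E1) (z\<^sup>2)
      + of_real c * eval_fps (cfps E) (z\<^sup>2) = of_real (bessel_Q a b c \<nu>) * eval_fps (cfps (bessel_phi a b c \<nu>)) (z\<^sup>2)"
  proof -
    have s: "(\<lambda>n. cfps X $ n * (z\<^sup>2) ^ n) sums eval_fps (cfps X) (z\<^sup>2)" if "fps_conv_radius X = \<infinity>" for X
      using that by (intro sums_eval_fps) simp
    have "(\<lambda>n. of_real a * (cfps E2 $ n * (z\<^sup>2) ^ n) + of_real b * (cfps E1 $ n * (z\<^sup>2) ^ n)
        + of_real c * (cfps E $ n * (z\<^sup>2) ^ n)) sums (of_real a * eval_fps (cfps E2) (z\<^sup>2) + of_real b * eval_fps (cfps E1) (z\<^sup>2)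
      + of_real c * eval_fps (cfps E) (z\<^sup>2))"
      by (intro sums_add sums_mult s r)
    moreover have "of_real a * (cfps E2 $ n * (z\<^sup>2) ^ n) + of_real b * (cfps E1 $ n * (z\<^sup>2) ^ n)
        + of_real c * (cfps E $ n * (z\<^sup>2) ^ n) = of_real (bessel_Q a b c \<nu>) * (cfps (bessel_phi a b c \<nu>) $ n * (z\<^sup>2) ^ n)" for n
    proof -
      have "of_real a * (cfps E2 $ n * (z\<^sup>2) ^ n) + of_real b * (cfps E1 $ n * (z\<^sup>2) ^ n)
        + of_real c * (cfps E $ n * (z\<^sup>2) ^ n) = of_real (a * E2 $ n + b * E1 $ n + c * E $ n) * (z\<^sup>2) ^ n"
        by (simp add: algebra_simps)
      also have "a * E2 $ n + b * E1 $ n + c * E $ n = bessel_Q a b c (\<nu> + 2 * real n) * E $ n"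
        by (simp add: E1_def E2_def euler_op_nth bessel_Q_def algebra_simps)
      also have "\<dots> = bessel_Q a b c \<nu> * bessel_phi a b c \<nu> $ n"
        using Q by (simp add: bessel_phi_def E_def)
      finally show ?thesis by simp
    qed
    ultimately have *: "(\<lambda>n. of_real (bessel_Q a b c \<nu>) * (cfps (bessel_phi a b c \<nu>) $ n * (z\<^sup>2) ^ n)) sums
      (of_real a * eval_fps (cfps E2) (z\<^sup>2) + of_real b * eval_fps (cfps E1) (z\<^sup>2)
      + of_real c * eval_fps (cfps E) (z\<^sup>2))" by simp
    then have "(\<lambda>n. cfps (bessel_phi a b c \<nu>) $ n * (z\<^sup>2) ^ n) sums
      ((of_real a * eval_fps (cfps E2) (z\<^sup>2) + of_real b * eval_fps (cfps E1) (z\<^sup>2)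
      + of_real c * eval_fps (cfps E) (z\<^sup>2)) / of_real (bessel_Q a b c \<nu>))"
      using sums_divide[OF *, of "of_real (bessel_Q a b c \<nu>)"] Q by simp
    then show ?thesis
      unfolding eval_fps_def using Q by (simp add: sums_iff)
  qed
  finally show ?thesis by (simp add: K_def mult_ac)
qed

lemma entire_eqI_off_slit:
  assumes "f holomorphic_on UNIV" "g holomorphic_on UNIV"
    and "\<And>z. z \<notin> \<real>\<^sub>\<le>\<^sub>0 \<Longrightarrow> f z = g z"
  shows "f = g"
proof
  fix z :: complex
  have "(1::complex) \<in> - \<real>\<^sub>\<le>\<^sub>0" by simp
  then have ne: "- \<real>\<^sub>\<le>\<^sub>0 \<noteq> ({} :: complex set)" by blast
  show "f z = g z"
    by (rule analytic_continuation_open[of "- \<real>\<^sub>\<le>\<^sub>0" UNIV])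
       (use assms ne in \<open>auto simp: open_Compl\<close>)
qed

lemma the_entire_eqI:
  assumes "f holomorphic_on UNIV" "\<And>z. z \<notin> \<real>\<^sub>\<le>\<^sub>0 \<Longrightarrow> f z = F z"
  shows "(THE f. f holomorphic_on UNIV \<and> (\<forall>z. z \<notin> \<real>\<^sub>\<le>\<^sub>0 \<longrightarrow> f z = F z)) = f"
proof (rule the_equality)
  fix g assume "g holomorphic_on UNIV \<and> (\<forall>z. z \<notin> \<real>\<^sub>\<le>\<^sub>0 \<longrightarrow> g z = F z)"
  with assms show "g = f" by (intro entire_eqI_off_slit) auto
qed (use assms in auto)

lemma cancel_normalisation:
  fixes k q :: complex
  assumes "k \<noteq> 0" "q \<noteq> 0"
  shows "k * p / q * (q * p' * f / k) = p * p' * f"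
  using assms by (simp add: field_simps)

lemma bessel_g_eq:
  assumes \<nu>: "\<nu> \<ge> 0" and Q: "bessel_Q a b c \<nu> \<noteq> 0" and r: "fps_conv_radius (bessel_phi a b c \<nu>) = \<infinity>"
  shows "bessel_g a b c \<nu> = (\<lambda>z. z * eval_fps (cfps (bessel_phi a b c \<nu>)) (z\<^sup>2))"
  unfolding bessel_g_def
proof (rule the_entire_eqI)
  show "(\<lambda>z. z * eval_fps (cfps (bessel_phi a b c \<nu>)) (z\<^sup>2)) holomorphic_on UNIV"
  proof -
    have "(eval_fps (cfps (bessel_phi a b c \<nu>)) \<circ> (\<lambda>z. z\<^sup>2)) holomorphic_on UNIV"
      by (rule holomorphic_on_compose) (use r in \<open>auto intro!: holomorphic_intros holomorphic_on_eval_fps\<close>)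
    then show ?thesis by (auto intro!: holomorphic_intros simp: o_def)
  qed
  fix z :: complex assume z: "z \<notin> \<real>\<^sub>\<le>\<^sub>0"
  have z0: "z \<noteq> 0" using z by auto
  have "Gamma (\<nu> + 1) > 0" using \<nu> by (intro Gamma_real_pos) simp
  then have K: "complex_of_real (2 powr \<nu> * Gamma (\<nu> + 1)) \<noteq> 0" by simp
  have "z powr of_real (1 - \<nu>) * z powr of_real \<nu> = z"
    using z0 by (simp flip: powr_add)
  then show "z * eval_fps (cfps (bessel_phi a b c \<nu>)) (z\<^sup>2) =
      complex_of_real (2 powr \<nu> * Gamma (\<nu> + 1)) * z powr complex_of_real (1 - \<nu>)
                 / complex_of_real (bessel_Q a b c \<nu>) * bessel_N a b c \<nu> z"
    unfolding bessel_N_eq[OF \<nu> z Q] using cancel_normalisation[OF K, of "of_real (bessel_Q a b c \<nu>)"] Q by simp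
qed

lemma bessel_h_eq:
  assumes \<nu>: "\<nu> \<ge> 0" and Q: "bessel_Q a b c \<nu> \<noteq> 0" and r: "fps_conv_radius (bessel_phi a b c \<nu>) = \<infinity>"
  shows "bessel_h a b c \<nu> = (\<lambda>z. z * eval_fps (cfps (bessel_phi a b c \<nu>)) z)"
  unfolding bessel_h_def
proof (rule the_entire_eqI)
  show "(\<lambda>z. z * eval_fps (cfps (bessel_phi a b c \<nu>)) z) holomorphic_on UNIV"
    using r by (intro holomorphic_intros) simp
  fix z :: complex assume z: "z \<notin> \<real>\<^sub>\<le>\<^sub>0"
  have z0: "z \<noteq> 0" using z by auto
  have "Gamma (\<nu> + 1) > 0" using \<nu> by (intro Gamma_real_pos) simp
  then have K: "complex_of_real (2 powr \<nu> * Gamma (\<nu> + 1)) \<noteq> 0" by simp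
  have cz: "csqrt z \<notin> \<real>\<^sub>\<le>\<^sub>0" using z0 by simp
  have "Ln (csqrt z) = Ln z / 2"
    unfolding csqrt_exp_Ln[OF z0] using z0 mpi_less_Im_Ln[OF z0] Im_Ln_le_pi[OF z0] pi_gt_zero
    by (intro Ln_exp) simp_all
  then have csqrt_powr: "csqrt z powr of_real \<nu> = z powr of_real (\<nu> / 2)"
    using z0 by (simp only: powr_def csqrt_eq_0 if_False) simp
  moreover have "z powr of_real (1 - \<nu> / 2) * z powr of_real (\<nu> / 2) = z"
    using z0 by (simp flip: powr_add)
  ultimately show "z * eval_fps (cfps (bessel_phi a b c \<nu>)) z =
      complex_of_real (2 powr \<nu> * Gamma (\<nu> + 1)) * z powr complex_of_real (1 - \<nu> / 2)
                 / complex_of_real (bessel_Q a b c \<nu>) * bessel_N a b c \<nu> (csqrt z)"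
    unfolding bessel_N_eq[OF \<nu> cz Q] csqrt_powr using cancel_normalisation[OF K, of "of_real (bessel_Q a b c \<nu>)"] Q by simp
qed

section \<open>Radius of convexity\<close>

lemma Sup_ereal_initial_segment:
  assumes "\<rho> > 0" "\<And>r. r > 0 \<Longrightarrow> P r \<longleftrightarrow> r \<le> \<rho>"
  shows "Sup (ereal ` {r. r > 0 \<and> P r}) = ereal \<rho>"
proof (rule antisym)
  show "Sup (ereal ` {r. r > 0 \<and> P r}) \<le> ereal \<rho>"
    by (rule Sup_least) (use assms in auto)
  show "ereal \<rho> \<le> Sup (ereal ` {r. r > 0 \<and> P r})"
    by (rule Sup_upper) (use assms in auto)
qed

text \<open>
  The convexity condition in the variable \<open>w\<close>, where \<open>G\<close> is the series of the derivative and
  \<open>\<sigma>\<close> is \<open>1\<close> for \<open>w = z\<close> and \<open>2\<close> for \<open>w = z^2\<close>.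
\<close>

definition convex_on_ball :: "real \<Rightarrow> real fps \<Rightarrow> real \<Rightarrow> bool" where
  "convex_on_ball \<sigma> G r \<longleftrightarrow> (\<forall>w\<in>ball 0 r. eval_fps (cfps G) w \<noteq> 0 \<and>
           Re (1 + of_real \<sigma> * w * eval_fps (fps_deriv (cfps G)) w / eval_fps (cfps G) w) > 0)"

lemma radius_of_convexity_series:
  assumes \<phi>: "fps_conv_radius \<phi> = \<infinity>" and "\<rho> > 0"
    and conv: "\<And>r. r > 0 \<Longrightarrow> convex_on_ball 1 (euler_op 1 1 \<phi>) r \<longleftrightarrow> r \<le> \<rho>"
  shows "radius_of_convexity (\<lambda>z. z * eval_fps (cfps \<phi>) z) = ereal \<rho>"
proof -
  let ?f = "\<lambda>z. z * eval_fps (cfps \<phi>) z"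
  let ?G = "cfps (euler_op 1 1 \<phi>)"
  have G: "fps_conv_radius ?G = \<infinity>" using \<phi> by (simp add: fps_conv_radius_euler_op)
  have d1: "deriv ?f = eval_fps ?G"
  proof
    fix z
    have "(?f has_field_derivative z * eval_fps (fps_deriv (cfps \<phi>)) z + 1 * eval_fps (cfps \<phi>) z) (at z)"
      by (intro DERIV_mult' DERIV_ident has_field_derivative_eval_fps) (use \<phi> in simp)
    then show "deriv ?f z = eval_fps ?G z"
      using \<phi> by (intro DERIV_imp_deriv) (simp add: cfps_euler_op eval_euler_op add.commute)
  qed
  have d2: "deriv (deriv ?f) z = eval_fps (fps_deriv ?G) z" for z
    unfolding d1 by (intro DERIV_imp_deriv has_field_derivative_eval_fps) (use G in simp)
  show ?thesis
    unfolding radius_of_convexity_def d2 unfolding d1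
    by (rule Sup_ereal_initial_segment[OF \<open>\<rho> > 0\<close>]) (use conv in \<open>simp add: convex_on_ball_def\<close>)
qed

lemma radius_of_convexity_odd_series:
  assumes \<phi>: "fps_conv_radius \<phi> = \<infinity>" and \<rho>: "\<rho> > 0"
    and conv: "\<And>r. r > 0 \<Longrightarrow> convex_on_ball 2 (euler_op 1 2 \<phi>) r \<longleftrightarrow> r \<le> \<rho>"
  shows "radius_of_convexity (\<lambda>z. z * eval_fps (cfps \<phi>) (z\<^sup>2)) = ereal (sqrt \<rho>)"
proof -
  let ?f = "\<lambda>z. z * eval_fps (cfps \<phi>) (z\<^sup>2)"
  let ?G = "cfps (euler_op 1 2 \<phi>)"
  have G: "fps_conv_radius ?G = \<infinity>" using \<phi> by (simp add: fps_conv_radius_euler_op)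
  have chain: "((\<lambda>z. eval_fps F (z\<^sup>2)) has_field_derivative eval_fps (fps_deriv F) (z\<^sup>2) * (2 * z)) (at z)"
    if "fps_conv_radius F = \<infinity>" for F :: "complex fps" and z
    by (rule DERIV_chain2[OF has_field_derivative_eval_fps])
       (use that in \<open>auto intro!: derivative_eq_intros\<close>)
  have d1: "deriv ?f = (\<lambda>z. eval_fps ?G (z\<^sup>2))"
  proof
    fix z
    have "(?f has_field_derivative z * (eval_fps (fps_deriv (cfps \<phi>)) (z\<^sup>2) * (2 * z)) + 1 * eval_fps (cfps \<phi>) (z\<^sup>2)) (at z)"
      by (intro DERIV_mult' DERIV_ident chain) (use \<phi> in simp)
    also have "z * (eval_fps (fps_deriv (cfps \<phi>)) (z\<^sup>2) * (2 * z)) + 1 * eval_fps (cfps \<phi>) (z\<^sup>2) = eval_fps ?G (z\<^sup>2)"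
      using \<phi> by (simp add: cfps_euler_op eval_euler_op power2_eq_square)
    finally show "deriv ?f z = eval_fps ?G (z\<^sup>2)"
      by (rule DERIV_imp_deriv)
  qed
  have d2: "deriv (deriv ?f) z = eval_fps (fps_deriv ?G) (z\<^sup>2) * (2 * z)" for z
    unfolding d1 by (rule DERIV_imp_deriv[OF chain[OF G]])
  have squares: "(\<lambda>z. z\<^sup>2) ` ball 0 r = (ball 0 (r\<^sup>2) :: complex set)" if r: "r > 0" for r
  proof safe
    fix z :: complex assume "z \<in> ball 0 r"
    then have "norm z ^ 2 < r\<^sup>2" by (intro power_strict_mono) simp_all
    then show "z\<^sup>2 \<in> ball 0 (r\<^sup>2)" by (simp add: norm_power)
  next
    fix w :: complex assume w: "w \<in> ball 0 (r\<^sup>2)"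
    have "norm (csqrt w) ^ 2 = norm w" by (simp flip: norm_power)
    then have "norm (csqrt w) < r"
      using w r by (intro power_less_imp_less_base[of _ 2 r]) simp_all
    then show "w \<in> (\<lambda>z. z\<^sup>2) ` ball 0 r"
      by (intro image_eqI[of _ _ "csqrt w"]) simp_all
  qed
  show ?thesis
    unfolding radius_of_convexity_def d2 unfolding d1
  proof (rule Sup_ereal_initial_segment)
    show "sqrt \<rho> > 0" using \<rho> by simp
    fix r :: real assume r: "r > 0"
    have "(\<forall>z\<in>ball 0 r. eval_fps ?G (z\<^sup>2) \<noteq> 0 \<and>
        0 < Re (1 + z * (eval_fps (fps_deriv ?G) (z\<^sup>2) * (2 * z)) / eval_fps ?G (z\<^sup>2))) \<longleftrightarrow>
      (\<forall>w\<in>(\<lambda>z. z\<^sup>2) ` ball 0 r. eval_fps ?G w \<noteq> 0 \<and>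
        0 < Re (1 + of_real 2 * w * eval_fps (fps_deriv ?G) w / eval_fps ?G w))"
      by (simp add: power2_eq_square mult_ac)
    also have "\<dots> \<longleftrightarrow> convex_on_ball 2 (euler_op 1 2 \<phi>) (r\<^sup>2)"
      unfolding squares[OF r] convex_on_ball_def ..
    also have "\<dots> \<longleftrightarrow> r\<^sup>2 \<le> \<rho>" using r by (intro conv) simp
    also have "\<dots> \<longleftrightarrow> r \<le> sqrt \<rho>"
      using real_sqrt_le_iff[of "r\<^sup>2" \<rho>] r by simp
    finally show "(\<forall>z\<in>ball 0 r. eval_fps ?G (z\<^sup>2) \<noteq> 0 \<and>
        0 < Re (1 + z * (eval_fps (fps_deriv ?G) (z\<^sup>2) * (2 * z)) / eval_fps ?G (z\<^sup>2))) \<longleftrightarrow> r \<le> sqrt \<rho>" .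
  qed
qed

text \<open>
  As \<open>Q \<nu> \<noteq> 0\<close>, the polynomial \<open>Q\<close> is not zero and its set of roots is finite, so that
  \<open>largest_root_Q\<close> is a genuine maximum.
\<close>

lemma roots_less_of_max_zero_root:
  assumes nu: "\<nu> \<ge> max_zero_root_Q a b c" and Q: "bessel_Q a b c \<nu> \<noteq> 0"
  shows "\<nu> \<ge> 0" and "bessel_Q a b c x = 0 \<Longrightarrow> x < \<nu>"
proof -
  have fin: "finite {x. bessel_Q a b c x = 0}"
  proof -
    let ?p = "[:c, b - a, a:]"
    have p: "poly ?p x = bessel_Q a b c x" for x
      by (simp add: bessel_Q_def algebra_simps)
    with Q have "?p \<noteq> 0" by (metis poly_0)
    then have "finite {x. poly ?p x = 0}" by (rule poly_roots_finite)
    then show ?thesis unfolding p .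
  qed
  show "\<nu> \<ge> 0"
    using nu by (auto simp: max_zero_root_Q_def split: if_splits)
  show "x < \<nu>" if x: "bessel_Q a b c x = 0"
  proof -
    have "x \<le> largest_root_Q a b c"
      unfolding largest_root_Q_def using x fin by (intro Max_ge) auto
    also have "\<dots> \<le> \<nu>"
      using nu x by (auto simp: max_zero_root_Q_def split: if_splits)
    finally show ?thesis using x Q by (cases "x = \<nu>") auto
  qed
qed

text \<open>
  The \<open>e k\<close> are the absolute values of the coefficients of \<open>F\<close>, that is, the elementary symmetric
  functions of the reciprocal zeros, and \<open>s1, s2, s3\<close> are the power sums by Newton's identities.
\<close>

lemma bessel_convexity_radius_bounds:
  fixes a b c \<nu> \<sigma> :: real
  assumes abc: "(c = 0 \<and> a \<noteq> b) \<or> (c > 0 \<and> a < b)"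
    and \<nu>: "\<nu> \<ge> 0" and Q_nz: "bessel_Q a b c \<nu> \<noteq> 0"
    and roots: "\<And>x. bessel_Q a b c x = 0 \<Longrightarrow> x < \<nu>"
    and \<sigma>: "\<sigma> \<ge> 0"
  defines "e k \<equiv> (1 + \<sigma> * real k)\<^sup>2 * bessel_Q a b c (\<nu> + 2 * real k)
      / (fact k * 4 ^ k * pochhammer (\<nu> + 1) k * bessel_Q a b c \<nu>)"
  defines "s1 \<equiv> e 1" and "s2 \<equiv> (e 1)\<^sup>2 - 2 * e 2" and "s3 \<equiv> e 1 ^ 3 - 3 * e 1 * e 2 + 3 * e 3"
  obtains \<rho> where "fps_conv_radius (bessel_phi a b c \<nu>) = \<infinity>" "\<rho> > 0"
    "\<And>r. convex_on_ball \<sigma> (euler_op 1 \<sigma> (bessel_phi a b c \<nu>)) r \<longleftrightarrow> r \<le> \<rho>"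
    "1 / s1 < \<rho>" "1 / sqrt s2 < \<rho>" "\<rho> < s1 / s2" "\<rho> < s2 / s3" "s2 > 0"
    "\<And>k. bessel_Q a b c (\<nu> + 2 * real k) / bessel_Q a b c \<nu> > 0"
proof -
  let ?Q = "bessel_Q a b c"
  define \<phi> where "\<phi> = bessel_phi a b c \<nu>"
  define G where "G = euler_op 1 \<sigma> \<phi>"
  define F where "F = euler_op 1 \<sigma> G"
  note props = bessel_phi_props[OF abc \<nu> Q_nz roots]
  obtain \<alpha> \<beta> where ab: "\<alpha> \<ge> 0" "\<beta> \<ge> 0"
    "\<And>n. ?Q (\<nu> + 2 * real n) / ?Q \<nu> = 1 + \<alpha> * real n + \<beta> * (real n)\<^sup>2"
    using props(2) by blast
  have lim\<phi>: "lin_prod_limit \<phi>" unfolding \<phi>_def by (rule props(1))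
  then have limG: "lin_prod_limit G" unfolding G_def using \<sigma> by (rule lin_prod_limit_euler)
  then have limF: "lin_prod_limit F" unfolding F_def using \<sigma> by (rule lin_prod_limit_euler)
  have \<phi>_nth: "\<phi> $ n = bessel_base \<nu> $ n * (1 + \<alpha> * real n + \<beta> * (real n)\<^sup>2)" for n
    by (simp add: \<phi>_def bessel_phi_def ab(3))
  have conv\<phi>: "fps_conv_radius \<phi> = \<infinity>"
  proof -
    have "\<phi> $ n = (1 + \<sigma> * real n) ^ 0 * (bessel_base \<nu> $ n * (1 + \<alpha> * real n + \<beta> * (real n)\<^sup>2))" for n
      by (simp add: \<phi>_nth)
    note d = bessel_coeffs_sign_and_decay[OF \<nu> \<sigma> ab(1,2) this]
    have "\<phi> $ n \<noteq> 0" for n using d(1)[of n] by (metis less_irrefl mult_zero_right)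
    then show ?thesis using d(2) by (rule fps_conv_radius_infinite)
  qed
  have F_nth: "F $ n = (1 + \<sigma> * real n) ^ 2 * (bessel_base \<nu> $ n * (1 + \<alpha> * real n + \<beta> * (real n)\<^sup>2))" for n
    by (simp add: F_def G_def euler_op_nth \<phi>_nth power2_eq_square)
  note decayF = bessel_coeffs_sign_and_decay[OF \<nu> \<sigma> ab(1,2) F_nth]
  define s where "s = (\<lambda>k. neg_log_deriv F $ (k - 1))"
  have strict: "strict_power_sum_seq s"
    unfolding s_def by (rule strict_power_sum_seq_log_deriv[OF limF decayF])
  interpret strict_power_sum_seq s by (rule strict)
  have sgn: "F $ k = (-1) ^ k * e k" for k
    unfolding F_nth ab(3)[symmetric] by (simp add: e_def bessel_base_def)
  have F0: "F $ 0 = 1" by (rule lin_prod_limit_nth_0[OF limF])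
  have s1: "s 1 = s1"
    unfolding s_def s1_def by (subst neg_log_deriv_nth[OF F0]) (simp add: sgn)
  have s2: "s 2 = s2"
  proof -
    have "s 2 = - 2 * F $ 2 - s 1 * F $ 1"
      unfolding s_def by (subst neg_log_deriv_nth[OF F0]) (simp add: numeral_2_eq_2)
    then show ?thesis
      unfolding s1 sgn s1_def s2_def by (simp add: power2_eq_square)
  qed
  have s3: "s 3 = s3"
  proof -
    have "s 3 = - 3 * F $ 3 - (s 1 * F $ 2 + s 2 * F $ 1)"
      unfolding s_def by (subst neg_log_deriv_nth[OF F0]) (simp add: numeral_2_eq_2 numeral_3_eq_3)
    then show ?thesis
      unfolding s1 s2 sgn s1_def s2_def s3_def by (simp add: algebra_simps power2_eq_square power3_eq_cube)
  qed
  obtain \<rho> where \<rho>: "fps_conv_radius (neg_log_deriv F) = ereal \<rho>" "0 < \<rho>"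
    "1 / s 1 < \<rho>" "1 / sqrt (s 2) < \<rho>" "\<rho> < s 1 / s 2" "\<rho> < s 2 / s 3"
    by (rule first_zero_bounds[OF strict, of "neg_log_deriv F"]) (simp_all add: s_def)
  interpret G: power_sum_seq "\<lambda>k. neg_log_deriv G $ (k - 1)"
    by (rule lin_prod_limit_power_sum_seq[OF limG])
  have "convex_on_ball \<sigma> G r \<longleftrightarrow> r \<le> \<rho>" for r
    unfolding convex_on_ball_def
  proof (subst convexity_condition_iff)
    show "G $ 0 = 1" by (rule lin_prod_limit_nth_0[OF limG])
    show "fps_conv_radius G = \<infinity>"
      unfolding G_def using conv\<phi> by (rule fps_conv_radius_euler_op)
    show "0 \<le> neg_log_deriv G $ n" for n
      using G.nonneg[of "Suc n"] by simp
    show "(ereal r \<le> fps_conv_radius (neg_log_deriv (euler_op 1 \<sigma> G))) = (r \<le> \<rho>)"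
      using \<rho>(1) by (simp add: F_def)
  qed (rule \<sigma>)
  moreover have "?Q (\<nu> + 2 * real k) / ?Q \<nu> > 0" for k
    unfolding ab(3) using ab(1,2) by (simp add: add_pos_nonneg)
  moreover have "s2 > 0" using s_pos[of 2] s2 by simp
  ultimately show ?thesis
    using \<rho>(2-) conv\<phi> unfolding s1 s2 s3 \<phi>_def G_def by (intro that) auto
qed

theorem theorem2p4:
  fixes a b c \<nu> :: real
  assumes abc: "(c = 0 \<and> a \<noteq> b) \<or> (c > 0 \<and> a < b)"
    and nu: "\<nu> \<ge> max_zero_root_Q a b c"
    and Q_nz: "bessel_Q a b c \<nu> \<noteq> 0"
  shows "let Q = bessel_Q a b c;
             rg = radius_of_convexity (bessel_g a b c \<nu>);
             rh = radius_of_convexity (bessel_h a b c \<nu>)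
         in
           (ereal (2 / 3 * sqrt ((\<nu> + 1) * Q \<nu> / Q (\<nu> + 2))) < rg
            \<and> rg < ereal (sqrt (36 * (\<nu> + 1) * (\<nu> + 2) * Q \<nu> * Q (\<nu> + 2)
                 / (81 * (\<nu> + 2) * (Q (\<nu> + 2))\<^sup>2 - 25 * (\<nu> + 1) * Q \<nu> * Q (\<nu> + 4))))
            \<and> ereal (root 4 (16 * (\<nu> + 1)\<^sup>2 * (\<nu> + 2) * (Q \<nu>)\<^sup>2
                 / (81 * (\<nu> + 2) * (Q (\<nu> + 2))\<^sup>2 - 25 * (\<nu> + 1) * Q \<nu> * Q (\<nu> + 4)))) < rg
            \<and> rg < ereal (sqrt (8 * (\<nu> + 1) * (\<nu> + 3) * Q \<nu>
                     * (81 * (\<nu> + 2) * (Q (\<nu> + 2))\<^sup>2 - 25 * (\<nu> + 1) * Q \<nu> * Q (\<nu> + 4))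
                 / (27 * (\<nu> + 3) * Q (\<nu> + 2)
                       * (54 * (\<nu> + 2) * (Q (\<nu> + 2))\<^sup>2 - 25 * (\<nu> + 1) * Q \<nu> * Q (\<nu> + 4))
                    + 49 * (\<nu> + 1)\<^sup>2 * (Q \<nu>)\<^sup>2 * Q (\<nu> + 6)))))
         \<and> (ereal ((\<nu> + 1) * Q \<nu> / Q (\<nu> + 2)) < rh
            \<and> rh < ereal (16 * (\<nu> + 1) * (\<nu> + 2) * Q \<nu> * Q (\<nu> + 2)
                 / (16 * (\<nu> + 2) * (Q (\<nu> + 2))\<^sup>2 - 9 * (\<nu> + 1) * Q \<nu> * Q (\<nu> + 4)))
            \<and> ereal (sqrt (16 * (\<nu> + 1) * (\<nu> + 2) * (Q \<nu>)\<^sup>2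
                 / (16 * (\<nu> + 2) * (Q (\<nu> + 2))\<^sup>2 - 9 * Q \<nu> * Q (\<nu> + 4)))) < rh
            \<and> ereal (sqrt (16 * (\<nu> + 1)\<^sup>2 * (\<nu> + 2) * (Q \<nu>)\<^sup>2
                 / (16 * (\<nu> + 2) * (Q (\<nu> + 2))\<^sup>2 - 9 * (\<nu> + 1) * Q \<nu> * Q (\<nu> + 4)))) < rh
            \<and> rh < ereal (2 * (\<nu> + 1) * (\<nu> + 3) * Q \<nu>
                     * (16 * (\<nu> + 2) * (Q (\<nu> + 2))\<^sup>2 - 9 * (\<nu> + 1) * Q \<nu> * Q (\<nu> + 4))
                 / ((\<nu> + 3) * Q (\<nu> + 2)
                       * (32 * (\<nu> + 2) * (Q (\<nu> + 2))\<^sup>2 - 27 * (\<nu> + 1) * Q \<nu> * Q (\<nu> + 4))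
                    + 4 * (\<nu> + 1)\<^sup>2 * (Q \<nu>)\<^sup>2 * Q (\<nu> + 6))))"
proof -
  define q where "q = bessel_Q a b c \<nu>"
  define A where "A = bessel_Q a b c (\<nu> + 2)"
  define B where "B = bessel_Q a b c (\<nu> + 4)"
  define C where "C = bessel_Q a b c (\<nu> + 6)"
  note r = roots_less_of_max_zero_root[OF nu Q_nz]
  have \<nu>: "\<nu> \<ge> 0" by (rule r(1))
  have q: "q \<noteq> 0" using Q_nz by (simp add: q_def)
  have nz: "\<nu> + 1 \<noteq> 0" "\<nu> + 2 \<noteq> 0" "\<nu> + 3 \<noteq> 0" using \<nu> by simp_all
  \<comment> \<open>With \<open>\<sigma> = 2\<close> these are the coefficients for \<open>g\<close>, with \<open>\<sigma> = 1\<close> those for \<open>h\<close>.\<close>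
  define e where "e \<sigma> k = (1 + \<sigma> * real k)\<^sup>2 * bessel_Q a b c (\<nu> + 2 * real k)
      / (fact k * 4 ^ k * pochhammer (\<nu> + 1) k * bessel_Q a b c \<nu>)" for \<sigma> k
  have p2: "pochhammer (\<nu> + 1) 2 = (\<nu> + 1) * (\<nu> + 2)"
    by (simp add: pochhammer_Suc eval_nat_numeral add_ac)
  have p3: "pochhammer (\<nu> + 1) 3 = (\<nu> + 1) * (\<nu> + 2) * (\<nu> + 3)"
    by (simp add: pochhammer_Suc eval_nat_numeral add_ac)
  have e1: "e \<sigma> 1 = (1 + \<sigma>)\<^sup>2 * A / (4 * (\<nu> + 1) * q)" for \<sigma>
    by (simp add: e_def A_def q_def)
  have e2: "e \<sigma> 2 = (1 + 2 * \<sigma>)\<^sup>2 * B / (32 * (\<nu> + 1) * (\<nu> + 2) * q)" for \<sigma>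
    by (simp add: e_def B_def q_def p2 mult.assoc mult.commute[of \<sigma>])
  have e3: "e \<sigma> 3 = (1 + 3 * \<sigma>)\<^sup>2 * C / (384 * (\<nu> + 1) * (\<nu> + 2) * (\<nu> + 3) * q)" for \<sigma>
    by (simp add: e_def C_def q_def p3 fact_numeral mult.assoc mult.commute[of \<sigma>])
  \<comment> \<open>\<open>Dg, Dh\<close> and \<open>Tg, Th\<close> are the numerators of the second and third power sums.\<close>
  define Dg where "Dg = 81 * (\<nu> + 2) * A\<^sup>2 - 25 * (\<nu> + 1) * q * B"
  define Tg where "Tg = 27 * (\<nu> + 3) * A * (54 * (\<nu> + 2) * A\<^sup>2 - 25 * (\<nu> + 1) * q * B) + 49 * (\<nu> + 1)\<^sup>2 * q\<^sup>2 * C"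
  define Dh where "Dh = 16 * (\<nu> + 2) * A\<^sup>2 - 9 * (\<nu> + 1) * q * B"
  define Th where "Th = (\<nu> + 3) * A * (32 * (\<nu> + 2) * A\<^sup>2 - 27 * (\<nu> + 1) * q * B) + 4 * (\<nu> + 1)\<^sup>2 * q\<^sup>2 * C"

  obtain \<rho>g where g: "fps_conv_radius (bessel_phi a b c \<nu>) = \<infinity>" "\<rho>g > 0"
    "\<And>r. convex_on_ball 2 (euler_op 1 2 (bessel_phi a b c \<nu>)) r \<longleftrightarrow> r \<le> \<rho>g"
    "1 / e 2 1 < \<rho>g" "1 / sqrt ((e 2 1)\<^sup>2 - 2 * e 2 2) < \<rho>g"
    "\<rho>g < e 2 1 / ((e 2 1)\<^sup>2 - 2 * e 2 2)"
    "\<rho>g < ((e 2 1)\<^sup>2 - 2 * e 2 2) / (e 2 1 ^ 3 - 3 * e 2 1 * e 2 2 + 3 * e 2 3)"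
    unfolding e_def
    by (rule bessel_convexity_radius_bounds[OF abc \<nu> Q_nz r(2), of 2]) auto
  obtain \<rho>h where h: "\<rho>h > 0"
    "\<And>r. convex_on_ball 1 (euler_op 1 1 (bessel_phi a b c \<nu>)) r \<longleftrightarrow> r \<le> \<rho>h"
    "1 / e 1 1 < \<rho>h" "1 / sqrt ((e 1 1)\<^sup>2 - 2 * e 1 2) < \<rho>h"
    "\<rho>h < e 1 1 / ((e 1 1)\<^sup>2 - 2 * e 1 2)"
    "\<rho>h < ((e 1 1)\<^sup>2 - 2 * e 1 2) / (e 1 1 ^ 3 - 3 * e 1 1 * e 1 2 + 3 * e 1 3)"
    "(e 1 1)\<^sup>2 - 2 * e 1 2 > 0"
    and quot: "\<And>k. bessel_Q a b c (\<nu> + 2 * real k) / bessel_Q a b c \<nu> > 0"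
    unfolding e_def
    by (rule bessel_convexity_radius_bounds[OF abc \<nu> Q_nz r(2), of 1]) auto

  have rg: "radius_of_convexity (bessel_g a b c \<nu>) = ereal (sqrt \<rho>g)"
    unfolding bessel_g_eq[OF \<nu> Q_nz g(1)] by (rule radius_of_convexity_odd_series[OF g(1,2,3)])
  have rh: "radius_of_convexity (bessel_h a b c \<nu>) = ereal \<rho>h"
    unfolding bessel_h_eq[OF \<nu> Q_nz g(1)] by (rule radius_of_convexity_series[OF g(1) h(1,2)])

  have s1g: "e 2 1 = 9 * A / (4 * (\<nu> + 1) * q)" unfolding e1 by simp
  have s2g: "(e 2 1)\<^sup>2 - 2 * e 2 2 = Dg / (16 * (\<nu> + 1)\<^sup>2 * (\<nu> + 2) * q\<^sup>2)"
    unfolding e1 e2 Dg_def using nz q by (simp add: divide_simps) (simp add: algebra_simps power2_eq_square)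
  have s3g: "e 2 1 ^ 3 - 3 * e 2 1 * e 2 2 + 3 * e 2 3 = Tg / (128 * (\<nu> + 1) ^ 3 * (\<nu> + 2) * (\<nu> + 3) * q ^ 3)"
    unfolding e1 e2 e3 Tg_def using nz q by (simp add: divide_simps) (simp add: algebra_simps power2_eq_square power3_eq_cube)
  have s1h: "e 1 1 = A / ((\<nu> + 1) * q)" unfolding e1 mult.assoc by simp
  have s2h: "(e 1 1)\<^sup>2 - 2 * e 1 2 = Dh / (16 * (\<nu> + 1)\<^sup>2 * (\<nu> + 2) * q\<^sup>2)"
    unfolding e1 e2 Dh_def using nz q by (simp add: divide_simps) (simp add: algebra_simps power2_eq_square)
  have s3h: "e 1 1 ^ 3 - 3 * e 1 1 * e 1 2 + 3 * e 1 3 = Th / (32 * (\<nu> + 1) ^ 3 * (\<nu> + 2) * (\<nu> + 3) * q ^ 3)"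
    unfolding e1 e2 e3 Th_def using nz q by (simp add: divide_simps) (simp add: algebra_simps power2_eq_square power3_eq_cube)

  have g1: "2 / 3 * sqrt ((\<nu> + 1) * q / A) < sqrt \<rho>g"
  proof -
    have "2 / 3 * sqrt ((\<nu> + 1) * q / A) = sqrt (4 / 9) * sqrt ((\<nu> + 1) * q / A)"
      by (simp add: real_sqrt_divide)
    also have "\<dots> = sqrt (1 / e 2 1)"
      unfolding s1g real_sqrt_mult[symmetric] by simp
    also have "\<dots> < sqrt \<rho>g" using g(4) by simp
    finally show ?thesis .
  qed
  have g2: "sqrt \<rho>g < sqrt (36 * (\<nu> + 1) * (\<nu> + 2) * q * A / Dg)"
  proof -
    have "9 * A / (4 * (\<nu> + 1) * q) / (Dg / (16 * (\<nu> + 1)\<^sup>2 * (\<nu> + 2) * q\<^sup>2))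
      = 36 * (\<nu> + 1) * (\<nu> + 2) * q * A / Dg"
      using nz q by (simp add: divide_simps) (simp add: power2_eq_square algebra_simps)
    then show ?thesis using g(6)[unfolded s2g, unfolded s1g] by simp
  qed
  have g3: "root 4 (16 * (\<nu> + 1)\<^sup>2 * (\<nu> + 2) * q\<^sup>2 / Dg) < sqrt \<rho>g"
  proof -
    have "root 4 (16 * (\<nu> + 1)\<^sup>2 * (\<nu> + 2) * q\<^sup>2 / Dg) = sqrt (sqrt (1 / (Dg / (16 * (\<nu> + 1)\<^sup>2 * (\<nu> + 2) * q\<^sup>2))))"
      using real_root_mult_exp[of 2 2] by (simp add: sqrt_def)
    also have "\<dots> < sqrt \<rho>g"
      using g(5) unfolding s2g by (intro real_sqrt_less_mono) (simp add: real_sqrt_divide)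
    finally show ?thesis .
  qed
  have g4: "sqrt \<rho>g < sqrt (8 * (\<nu> + 1) * (\<nu> + 3) * q * Dg / Tg)"
  proof -
    have eq: "Dg / (16 * (\<nu> + 1)\<^sup>2 * (\<nu> + 2) * q\<^sup>2) / (Tg / (128 * (\<nu> + 1) ^ 3 * (\<nu> + 2) * (\<nu> + 3) * q ^ 3))
      = 8 * (\<nu> + 1) * (\<nu> + 3) * q * Dg / Tg"
      using nz q by (simp add: divide_simps) (simp add: power2_eq_square power3_eq_cube algebra_simps)
    show ?thesis using g(7) unfolding s2g s3g eq by (rule real_sqrt_less_mono)
  qed
  have h1: "(\<nu> + 1) * q / A < \<rho>h"
    using h(3) unfolding s1h by simp
  have h2: "\<rho>h < 16 * (\<nu> + 1) * (\<nu> + 2) * q * A / Dh"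
  proof -
    have "A / ((\<nu> + 1) * q) / (Dh / (16 * (\<nu> + 1)\<^sup>2 * (\<nu> + 2) * q\<^sup>2))
      = 16 * (\<nu> + 1) * (\<nu> + 2) * q * A / Dh"
      using nz q by (simp add: divide_simps) (simp add: power2_eq_square algebra_simps)
    then show ?thesis using h(5)[unfolded s2h, unfolded s1h] by simp
  qed
  have h4: "sqrt (16 * (\<nu> + 1)\<^sup>2 * (\<nu> + 2) * q\<^sup>2 / Dh) < \<rho>h"
    using h(4) unfolding s2h by (simp add: real_sqrt_divide)
  \<comment> \<open>Compared with \<open>h4\<close>, the numerator does not increase and the denominator does not decrease.\<close>
  have h3: "sqrt (16 * (\<nu> + 1) * (\<nu> + 2) * q\<^sup>2 / (16 * (\<nu> + 2) * A\<^sup>2 - 9 * q * B)) < \<rho>h"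
  proof -
    have "16 * (\<nu> + 1)\<^sup>2 * (\<nu> + 2) * q\<^sup>2 > 0"
      using \<nu> q nz by (intro mult_pos_pos) auto
    then have Dh: "Dh > 0"
      using h(7) unfolding s2h by (simp only: zero_less_divide_iff) linarith
    have "B / q > 0" using quot[of 2] by (simp add: B_def q_def)
    then have "q * B > 0" by (auto simp: zero_less_divide_iff zero_less_mult_iff)
    then have "\<nu> * (q * B) \<ge> 0" using \<nu> by simp
    then have le: "Dh \<le> 16 * (\<nu> + 2) * A\<^sup>2 - 9 * q * B"
      by (simp add: Dh_def algebra_simps)
    have "16 * (\<nu> + 1) * (\<nu> + 2) * q\<^sup>2 / (16 * (\<nu> + 2) * A\<^sup>2 - 9 * q * B)
        \<le> 16 * (\<nu> + 1)\<^sup>2 * (\<nu> + 2) * q\<^sup>2 / Dh"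
    proof (rule frac_le[OF _ _ Dh le])
      have "(\<nu> + 1) * 1 \<le> (\<nu> + 1)\<^sup>2"
        unfolding power2_eq_square using \<nu> by (intro mult_left_mono) simp_all
      then show "16 * (\<nu> + 1) * (\<nu> + 2) * q\<^sup>2 \<le> 16 * (\<nu> + 1)\<^sup>2 * (\<nu> + 2) * q\<^sup>2"
        using \<nu> by (intro mult_right_mono) simp_all
    qed (use \<nu> in simp)
    then show ?thesis using h4 by (meson le_less_trans real_sqrt_le_mono)
  qed
  have h5: "\<rho>h < 2 * (\<nu> + 1) * (\<nu> + 3) * q * Dh / Th"
  proof -
    have eq: "Dh / (16 * (\<nu> + 1)\<^sup>2 * (\<nu> + 2) * q\<^sup>2) / (Th / (32 * (\<nu> + 1) ^ 3 * (\<nu> + 2) * (\<nu> + 3) * q ^ 3))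
      = 2 * (\<nu> + 1) * (\<nu> + 3) * q * Dh / Th"
      using nz q by (simp add: divide_simps) (simp add: power2_eq_square power3_eq_cube algebra_simps)
    show ?thesis using h(6) unfolding s2h s3h eq .
  qed
  show ?thesis
    unfolding Let_def rg rh less_ereal.simps(1)
    using g1 g2 g3 g4 h1 h2 h3 h4 h5
    unfolding Dg_def Tg_def Dh_def Th_def q_def A_def B_def C_def by blast
qed

end
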